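(* Let $g\ge1$ be an integer and $m_1,\dots,m_{2g}\in\mathbb{R}$. Put $v_1(x)=1+\sum_{k=1}^{2g}\frac{m_k}{k!}x^k$, $u_1(x)=\log v_1(x)$ (for $x$ near $0$), $\kappa_n=u_1^{(n)}(0)$ for $1\le n\le 2g$, and $$q(x)=\det\left(x\,(\kappa_{i+j-1})_{1\le i,j\le g}-(\kappa_{i+j})_{1\le i,j\le g}\right).$$ Assume $q$ has degree $g$ and its roots are real, nonzero and pairwise distinct, labelled $r_1<\dots<r_g$. Let $V=(r_i^{\,j-1})_{1\le i,j\le g}$, $D=\mathrm{diag}(r_1,\dots,r_g)$, $\lambda=(\lambda_1,\dots,\lambda_g)^T=D^{-1}(V^T)^{-1}(\kappa_1,\dots,\kappa_g)^T$, and assume $\lambda_h>0$ for $1\le h\le g$. For real $C>1$ set $N_h(0)=\lfloor\lambda_hC\rfloor$ and $f_h=\exp r_h$ for $1\le h\le g$, and for $1\le n\le 2g$ $$\mu(C,n)=\sum_{\substack{n_1,\ldots,n_g\in\mathbb{N}_0\\ n_1+\ldots+n_g=n}}\frac{n!}{\prod_hn_h!}\prod_{h=1}^gr_h^{n_h}\sum_{k_1=0}^{n_1}\frac{N_1(0)!}{(N_1(0)-k_1)!}\left\{\begin{matrix}n_1\\ k_1\end{matrix}\right\}\cdots\sum_{k_g=0}^{n_g}\frac{N_g(0)!}{(N_g(0)-k_g)!}\left\{\begin{matrix}n_g\\ k_g\end{matrix}\right\}C^{-\sum_hk_h}.$$ For an integer $N\ge\max(1,\sum_hN_h(0))$ set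 $t=\lfloor-N\log(1-C^{-1})\rfloor$, and let $M(C,N,n)=\mathbb{E}\left(\left(\log\frac{p(t)}{p(0)}\right)^n\right)$ in the multi-group model with parameters $N,N_1(0),\dots,N_g(0),f_1,\dots,f_g$. Then for every $\varepsilon>0$: (i) there is $C_0>1$ such that for all real $C\ge C_0$ and all $1\le n\le 2g$, $|\mu(C,n)-m_n|<\varepsilon$; (ii) for every real $C>1$ such that $|\mu(C,n)-m_n|<\varepsilon$ for all $1\le n\le 2g$, there is $N_0$ such that for all integers $N\ge N_0$ and all $1\le n\le 2g$, $|M(C,N,n)-m_n|<\varepsilon$. In particular, choosing first $C$ and then $N$ sufficiently large, the first $2g$ moments of $\log(p(t)/p(0))$ approximate $m_1,\dots,m_{2g}$ with error less than $\varepsilon$.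
   Context: $\mathbb{N}_0$ denotes the nonnegative integers. The multi-group model with parameters $N,N_1(0),\dots,N_g(0),f_1,\dots,f_g$ (integers $N\ge1$, $N_h(0)\ge0$, $\sum_hN_h(0)\le N$; reals $0<f_1<\dots<f_g$): there are $N$ investors, divided at time $t$ into $g$ active groups of sizes $N_1(t),\dots,N_g(t)$ and $N-\sum_hN_h(t)$ inactive investors. The process $(N_1(t),\dots,N_g(t),p(t))_{t\in\mathbb{N}_0}$ starts from deterministic values, $p(0)>0$. At each time $t$, conditionally on the whole history up to time $t$, an investor is chosen uniformly at random among the $N$: with probability $N_h(t)/N$ an investor of group $h$ is chosen, in which case $p(t+1)=f_h\,p(t)$, $N_h(t+1)=N_h(t)-1$ and $N_i(t+1)=N_i(t)$ for $i\ne h$ (the investor becomes inactive); with probability $(N-\sum_hN_h(t))/N$ an inactive investor is chosen and nothing changes. $\left\{\begin{matrix}n\\ k\end{matrix}\right\}$ is the Stirling number of the second kind: the number of partitions of a set of $n$ elements into $k$ nonempty sets (so $\left\{\begin{matrix}0\\ 0\end{matrix}\right\}=1$). For integers $a,l\ge 0$, $\frac{a!}{(a-l)!}$ denotes the falling factorial $a(a-1)\cdots(a-l+1)$, which is $0$ if $l>a$. Convention: $0^0=1$. *)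

theory Defs
  imports
    "HOL-Probability.Probability"
    "HOL-Combinatorics.Stirling"
    "Jordan_Normal_Form.Determinant"
    "Jordan_Normal_Form.Gauss_Jordan_Elimination"
begin

text \<open>Groups, moments and cumulants are indexed from 1, as on paper; the matrices and vectors
  of Jordan-Normal-Form are indexed from 0, so the entry (i, j) on paper is at (i - 1, j - 1).
  Several names also exist in HOL-Analysis; the qualified ones are those of
  Jordan-Normal-Form.\<close>

section \<open>The multi-group model\<close>

text \<open>\<^term>\<open>G h t \<omega>\<close> is the size of group \<^term>\<open>h\<close> and \<^term>\<open>p t \<omega>\<close> the price at time
  \<^term>\<open>t\<close>.\<close>

definition has_history ::
    "nat \<Rightarrow> (nat \<Rightarrow> nat \<Rightarrow> 'a \<Rightarrow> nat) \<Rightarrow> (nat \<Rightarrow> 'a \<Rightarrow> real) \<Rightarrow> nat \<Rightarrow>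
      (nat \<Rightarrow> nat \<Rightarrow> nat) \<Rightarrow> (nat \<Rightarrow> real) \<Rightarrow> 'a \<Rightarrow> bool" where
  "has_history g G p t \<nu> \<pi> \<omega> \<longleftrightarrow>
     (\<forall>s\<le>t. (\<forall>h\<in>{1..g}. G h s \<omega> = \<nu> h s) \<and> p s \<omega> = \<pi> s)"

text \<open>The decrease of the group size is written as an increase, to avoid truncated
  subtraction.\<close>

definition active_step ::
    "nat \<Rightarrow> (nat \<Rightarrow> real) \<Rightarrow> (nat \<Rightarrow> nat \<Rightarrow> 'a \<Rightarrow> nat) \<Rightarrow> (nat \<Rightarrow> 'a \<Rightarrow> real) \<Rightarrow>
      nat \<Rightarrow> nat \<Rightarrow> 'a \<Rightarrow> bool" where
  "active_step g f G p h t \<omega> \<longleftrightarrow>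
     p (Suc t) \<omega> = f h * p t \<omega> \<and> G h t \<omega> = G h (Suc t) \<omega> + 1 \<and>
     (\<forall>i\<in>{1..g} - {h}. G i (Suc t) \<omega> = G i t \<omega>)"

definition inactive_step ::
    "nat \<Rightarrow> (nat \<Rightarrow> nat \<Rightarrow> 'a \<Rightarrow> nat) \<Rightarrow> (nat \<Rightarrow> 'a \<Rightarrow> real) \<Rightarrow> nat \<Rightarrow> 'a \<Rightarrow> bool" where
  "inactive_step g G p t \<omega> \<longleftrightarrow>
     p (Suc t) \<omega> = p t \<omega> \<and> (\<forall>i\<in>{1..g}. G i (Suc t) \<omega> = G i t \<omega>)"

text \<open>From deterministic initial values and with \<^term>\<open>g + 1\<close> possible transitions per step,
  the history takes finitely many values almost surely, so elementary conditioning on the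
  histories of positive probability expresses conditioning on the whole history.\<close>

locale multi_group_model = prob_space P
  for P :: "'a measure" +
  fixes N g :: nat and N0 :: "nat \<Rightarrow> nat" and f :: "nat \<Rightarrow> real" and p0 :: real
    and G :: "nat \<Rightarrow> nat \<Rightarrow> 'a \<Rightarrow> nat" and p :: "nat \<Rightarrow> 'a \<Rightarrow> real"
  assumes g_ge_1: "1 \<le> g"
    and N_ge_1: "1 \<le> N"
    and sum_N0_le: "(\<Sum>h=1..g. N0 h) \<le> N"
    and f_pos: "\<And>h. h \<in> {1..g} \<Longrightarrow> 0 < f h"
    and f_strict_mono: "strict_mono_on {1..g} f"
    and p0_pos: "0 < p0"
    and G_measurable: "\<And>h t. h \<in> {1..g} \<Longrightarrow> random_variable (count_space UNIV) (G h t)"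
    and p_measurable: "\<And>t. random_variable borel (p t)"
    and initial: "AE \<omega> in P. p 0 \<omega> = p0 \<and> (\<forall>h\<in>{1..g}. G h 0 \<omega> = N0 h)"
    and active: "\<And>t \<nu> \<pi> h. h \<in> {1..g} \<Longrightarrow>
      \<P>(\<omega> in P. has_history g G p t \<nu> \<pi> \<omega>) > 0 \<Longrightarrow>
      \<P>(\<omega> in P. active_step g f G p h t \<omega> \<bar> has_history g G p t \<nu> \<pi> \<omega>) = real (\<nu> h t) / real N"
    and inactive: "\<And>t \<nu> \<pi>.
      \<P>(\<omega> in P. has_history g G p t \<nu> \<pi> \<omega>) > 0 \<Longrightarrow>
      \<P>(\<omega> in P. inactive_step g G p t \<omega> \<bar> has_history g G p t \<nu> \<pi> \<omega>) =
        (real N - (\<Sum>h=1..g. real (\<nu> h t))) / real N"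


subsection \<open>Existence of the model\<close>

text \<open>Investors are numbered from 0 to \<^term>\<open>N - 1\<close> with the members of the active groups first;
  the sample space is the product of the uniform choices made at each time.\<close>

definition block :: "(nat \<Rightarrow> nat) \<Rightarrow> nat \<Rightarrow> nat set" where
  "block \<nu> h = {(\<Sum>j=1..<h. \<nu> j) ..< (\<Sum>j=1..<Suc h. \<nu> j)}"

definition choice_step ::
    "nat \<Rightarrow> (nat \<Rightarrow> real) \<Rightarrow> (nat \<Rightarrow> nat) \<times> real \<Rightarrow> nat \<Rightarrow> (nat \<Rightarrow> nat) \<times> real" where
  "choice_step g f s i =
     (if \<exists>h\<in>{1..g}. i \<in> block (fst s) h
      then let h = (SOME h. h \<in> {1..g} \<and> i \<in> block (fst s) h)
           in ((fst s)(h := fst s h - 1), f h * snd s)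
      else s)"

primrec choice_state ::
    "nat \<Rightarrow> (nat \<Rightarrow> real) \<Rightarrow> (nat \<Rightarrow> nat) \<times> real \<Rightarrow> nat \<Rightarrow> (nat \<Rightarrow> nat) \<Rightarrow> (nat \<Rightarrow> nat) \<times> real" where
  "choice_state g f s0 0 \<omega> = s0"
| "choice_state g f s0 (Suc t) \<omega> = choice_step g f (choice_state g f s0 t \<omega>) (\<omega> t)"

lemma block_unique:
  assumes "i \<in> block \<nu> h" "i \<in> block \<nu> h'" "1 \<le> h" "1 \<le> h'"
  shows "h = h'"
proof -
  have *: False if "a < b" "i \<in> block \<nu> a" "i \<in> block \<nu> b" "1 \<le> a" for a b
  proof -
    have "(\<Sum>j=1..<Suc a. \<nu> j) \<le> (\<Sum>j=1..<b. \<nu> j)"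
      using that by (intro sum_mono2) auto
    thus False using that by (auto simp: block_def)
  qed
  show ?thesis using *[of h h'] *[of h' h] assms by (meson linorder_neqE_nat)
qed

lemma card_block: "1 \<le> h \<Longrightarrow> card (block \<nu> h) = \<nu> h"
  by (simp add: block_def)

lemma Union_block: "(\<Union>h\<in>{1..g}. block \<nu> h) = {..<\<Sum>h=1..g. \<nu> h}"
proof (induction g)
  case (Suc g)
  have "{1..Suc g} = insert (Suc g) {1..g}" by auto
  moreover have "{1..<Suc g} = {1..g}" "{1..<Suc (Suc g)} = {1..Suc g}" by auto
  ultimately show ?case using Suc by (auto simp: block_def)
qed simp

lemma block_cong: "(\<And>j. j \<in> {1..h} \<Longrightarrow> \<nu> j = \<nu>' j) \<Longrightarrow> block \<nu> h = block \<nu>' h"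
  unfolding block_def by (intro arg_cong2[where f = atLeastLessThan] sum.cong) auto

lemma choice_step_block:
  assumes "h \<in> {1..g}" "i \<in> block (fst s) h"
  shows "choice_step g f s i = ((fst s)(h := fst s h - 1), f h * snd s)" "fst s h > 0"
proof -
  have "(SOME h. h \<in> {1..g} \<and> i \<in> block (fst s) h) = h"
  proof (rule some_equality)
    fix k assume "k \<in> {1..g} \<and> i \<in> block (fst s) k"
    thus "k = h" using assms block_unique[of i "fst s" k h] by simp
  qed (use assms in blast)
  thus "choice_step g f s i = ((fst s)(h := fst s h - 1), f h * snd s)"
    using assms by (auto simp: choice_step_def Let_def)
  show "fst s h > 0" using assms card_block[of h "fst s"]
    by (metis One_nat_def atLeastAtMost_iff card_eq_0_iff empty_iff gr0I block_def
        finite_atLeastLessThan)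
qed

lemma choice_step_no_block:
  assumes "\<And>h. h \<in> {1..g} \<Longrightarrow> i \<notin> block (fst s) h"
  shows "choice_step g f s i = s"
  using assms by (auto simp: choice_step_def)

lemma choice_step_active_iff:
  fixes f :: "nat \<Rightarrow> real" and s :: "(nat \<Rightarrow> nat) \<times> real" and i :: nat
  assumes "h \<in> {1..g}"
  defines "s' \<equiv> choice_step g f s i"
  shows "(snd s' = f h * snd s \<and> fst s h = fst s' h + 1 \<and>
      (\<forall>j\<in>{1..g}-{h}. fst s' j = fst s j)) \<longleftrightarrow> i \<in> block (fst s) h"
proof (cases "\<exists>k\<in>{1..g}. i \<in> block (fst s) k")
  case True
  then obtain k where k: "k \<in> {1..g}" "i \<in> block (fst s) k" by blast
  note c = choice_step_block(1)[OF k, of f] choice_step_block(2)[OF k]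
  show ?thesis
  proof (cases "k = h")
    case True
    thus ?thesis using k c unfolding s'_def by simp
  next
    case False
    hence "i \<notin> block (fst s) h" using block_unique k assms(1) by (metis atLeastAtMost_iff)
    moreover have "fst s' k \<noteq> fst s k" using c unfolding s'_def by simp
    ultimately show ?thesis using False k by blast
  qed
next
  case False
  hence "s' = s" unfolding s'_def by (intro choice_step_no_block) blast
  thus ?thesis using False assms(1) by auto
qed

lemma choice_step_inactive_iff:
  fixes g i :: nat and f :: "nat \<Rightarrow> real" and s :: "(nat \<Rightarrow> nat) \<times> real"
  defines "s' \<equiv> choice_step g f s i"
  shows "(snd s' = snd s \<and> (\<forall>j\<in>{1..g}. fst s' j = fst s j)) \<longleftrightarrow>
      i \<notin> {..<\<Sum>h=1..g. fst s h}"
proof (cases "\<exists>k\<in>{1..g}. i \<in> block (fst s) k")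
  case True
  then obtain k where k: "k \<in> {1..g}" "i \<in> block (fst s) k" by blast
  note c = choice_step_block(1)[OF k, of f] choice_step_block(2)[OF k]
  have "fst s' k \<noteq> fst s k" using c unfolding s'_def by simp
  moreover have "i \<in> (\<Union>h\<in>{1..g}. block (fst s) h)" using k by blast
  ultimately show ?thesis using k Union_block by metis
next
  case False
  hence "s' = s" unfolding s'_def by (intro choice_step_no_block) blast
  moreover have "i \<notin> (\<Union>h\<in>{1..g}. block (fst s) h)" using False by blast
  ultimately show ?thesis using Union_block by metis
qed

lemma choice_step_sum_le: "(\<Sum>h=1..g. fst (choice_step g f s i) h) \<le> (\<Sum>h=1..g. fst s h)"
proof (cases "\<exists>k\<in>{1..g}. i \<in> block (fst s) k")
  case True
  then obtain k where "k \<in> {1..g}" "i \<in> block (fst s) k" by blast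
  from choice_step_block(1)[OF this, of f] show ?thesis by (intro sum_mono) auto
next
  case False
  hence "choice_step g f s i = s" by (intro choice_step_no_block) blast
  thus ?thesis by simp
qed

lemma choice_state_sum_le:
  "(\<Sum>h=1..g. fst (choice_state g f s0 t \<omega>) h) \<le> (\<Sum>h=1..g. fst s0 h)"
proof (induction t)
  case (Suc t)
  show ?case
    unfolding choice_state.simps by (rule order_trans[OF choice_step_sum_le Suc])
qed simp

lemma choice_state_restrict:
  "s \<le> t \<Longrightarrow> choice_state g f s0 s \<omega> = choice_state g f s0 s (restrict \<omega> {..<t})"
  by (induction s) auto

theorem multi_group_model_exists:
  assumes "1 \<le> g" "1 \<le> N" "(\<Sum>h=1..g. N0 h) \<le> N" "\<And>h. h \<in> {1..g} \<Longrightarrow> 0 < f h"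
    "strict_mono_on {1..g} f" "0 < p0"
  shows "\<exists>(P :: (nat \<Rightarrow> nat) measure) G p. multi_group_model P N g N0 f p0 G p"
proof -
  define U where "U = measure_pmf (pmf_of_set {..<N})"
  define P where "P = Pi\<^sub>M (UNIV :: nat set) (\<lambda>_. U)"
  define S where "S = choice_state g f (N0, p0)"
  define G where "G = (\<lambda>h t \<omega>. fst (S t \<omega>) h)"
  define p where "p = (\<lambda>t \<omega>. snd (S t \<omega>))"
  interpret U: prob_space U unfolding U_def by (rule measure_pmf.prob_space_axioms)
  interpret PP: product_prob_space "\<lambda>_. U" "UNIV :: nat set" ..
  interpret P: prob_space P unfolding P_def by (rule PP.prob_space_axioms)
  have spU: "space U = UNIV" "sets U = UNIV" unfolding U_def by auto
  have spP: "space P = UNIV" unfolding P_def by (auto simp: space_PiM spU)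
  have coord: "(\<lambda>\<omega>. \<omega> t) \<in> measurable P U" for t unfolding P_def by measurable
  have sets_fin: "sets (PiM J (\<lambda>_. U)) = sets (count_space (PiE J (\<lambda>_. UNIV)))"
    if "finite J" for J :: "nat set"
  proof -
    have "sets (PiM J (\<lambda>_. U)) = sets (PiM J (\<lambda>_. count_space (UNIV :: nat set)))"
      by (intro sets_PiM_cong) (auto simp: spU)
    also have "\<dots> = sets (count_space (PiE J (\<lambda>_. UNIV)))"
      using that by (subst count_space_PiM_finite) auto
    finally show ?thesis .
  qed
  have rest: "(\<lambda>\<omega>. restrict \<omega> {..<t}) \<in> measurable P (PiM {..<t} (\<lambda>_. U))" for t
    unfolding P_def by (rule measurable_restrict_subset) simp
  have meas: "(\<lambda>\<omega>. F (restrict \<omega> {..<t})) \<in> measurable P M"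
    if "\<And>x. F x \<in> space M" for F :: "(nat \<Rightarrow> nat) \<Rightarrow> 'c" and M t
  proof (rule measurable_compose[OF rest[of t]])
    show "F \<in> measurable (PiM {..<t} (\<lambda>_. U)) M"
      using that by (subst measurable_cong_sets[OF sets_fin[OF finite_lessThan] refl]) auto
  qed
  have Sr: "S s \<omega> = S s (restrict \<omega> {..<t})" if "s \<le> t" for s t \<omega>
    unfolding S_def by (rule choice_state_restrict[OF that])
  have ind: "P.indep_vars (\<lambda>_. U) (\<lambda>i \<omega>. \<omega> i) UNIV"
  proof (subst P.indep_vars_iff_distr_eq_PiM)
    have "distr P U (\<lambda>\<omega>. \<omega> i) = U" for i
      unfolding P_def by (rule PP.PiM_component) simp
    thus "distr P (Pi\<^sub>M UNIV (\<lambda>_. U)) (\<lambda>x. \<lambda>i\<in>UNIV. x i) =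
        Pi\<^sub>M UNIV (\<lambda>i. distr P U (\<lambda>\<omega>. \<omega> i))"
      by (simp add: P_def restrict_def)
  qed (use coord in auto)
  have indep: "P.prob {\<omega>. H (restrict \<omega> {..<t}) \<and> \<omega> t \<in> B} =
      P.prob {\<omega>. H (restrict \<omega> {..<t})} * U.prob B" for H t B
  proof -
    let ?H = "{x \<in> PiE {..<t} (\<lambda>_. UNIV). H x}" and ?B = "{x \<in> PiE {t} (\<lambda>_. UNIV). x t \<in> B}"
    have iv: "P.indep_var (PiM {..<t} (\<lambda>_. U)) (\<lambda>\<omega>. restrict (\<lambda>i. \<omega> i) {..<t})
        (PiM {t} (\<lambda>_. U)) (\<lambda>\<omega>. restrict (\<lambda>i. \<omega> i) {t})"
      by (rule P.indep_var_restrict[OF ind]) auto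
    have "?H \<in> sets (PiM {..<t} (\<lambda>_. U))" "?B \<in> sets (PiM {t} (\<lambda>_. U))"
      by (subst sets_fin; auto)+
    from P.indep_varD[OF iv this]
    have "P.prob {\<omega>. H (restrict \<omega> {..<t}) \<and> \<omega> t \<in> B} =
        P.prob {\<omega>. H (restrict \<omega> {..<t})} * P.prob ((\<lambda>\<omega>. \<omega> t) -` B \<inter> space P)"
      by (simp add: spP vimage_def)
    moreover have "P.prob ((\<lambda>\<omega>. \<omega> t) -` B \<inter> space P) = U.prob B"
    proof -
      have "distr P U (\<lambda>\<omega>. \<omega> t) = U"
        unfolding P_def by (rule PP.PiM_component) simp
      thus ?thesis using measure_distr[OF coord[of t], of B] spU by simp
    qed
    ultimately show ?thesis by simp
  qed
  have hist: "has_history g G p t \<nu> \<pi> \<omega> = has_history g G p t \<nu> \<pi> (restrict \<omega> {..<t})" for t \<nu> \<pi> \<omega>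
    unfolding has_history_def G_def p_def using Sr[of _ t \<omega>] by auto
  have cond: "cond_prob P E (has_history g G p t \<nu> \<pi>) = U.prob B"
    if pos: "\<P>(\<omega> in P. has_history g G p t \<nu> \<pi> \<omega>) > 0"
      and E: "\<And>\<omega>. has_history g G p t \<nu> \<pi> \<omega> \<Longrightarrow> E \<omega> \<longleftrightarrow> \<omega> t \<in> B" for t \<nu> \<pi> E B
  proof -
    have "{\<omega>. E \<omega> \<and> has_history g G p t \<nu> \<pi> \<omega>} =
        {\<omega>. has_history g G p t \<nu> \<pi> (restrict \<omega> {..<t}) \<and> \<omega> t \<in> B}"
      using E hist by blast
    moreover have "{\<omega>. has_history g G p t \<nu> \<pi> \<omega>} =
        {\<omega>. has_history g G p t \<nu> \<pi> (restrict \<omega> {..<t})}"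
      using hist by blast
    ultimately have "\<P>(\<omega> in P. E \<omega> \<and> has_history g G p t \<nu> \<pi> \<omega>) =
        \<P>(\<omega> in P. has_history g G p t \<nu> \<pi> \<omega>) * U.prob B"
      by (simp add: spP indep)
    thus ?thesis using pos by (simp add: cond_prob_def)
  qed
  have probU: "U.prob B = real (card B) / real N" if "B \<subseteq> {..<N}" for B
    unfolding U_def using assms(2) that
    by (subst measure_pmf_of_set) (auto simp: Int_absorb1 lessThan_empty_iff)
  have le: "(\<Sum>h=1..g. G h t \<omega>) \<le> N" for t \<omega>
    using choice_state_sum_le[where g = g and f = f and ?s0.0 = "(N0, p0)" and t = t and \<omega> = \<omega>]
      assms(3) by (simp add: G_def S_def)
  have pos_ex: "\<exists>\<omega>. Q \<omega>" if "\<P>(\<omega> in P. Q \<omega>) > 0" for Q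
    using that by (metis (no_types, lifting) Collect_empty_eq less_irrefl measure_empty)
  show ?thesis
  proof (intro exI, unfold_locales)
    show "P.random_variable (count_space UNIV) (G h t)" for h t
      using meas[of "G h t" "count_space UNIV" t] unfolding G_def by (simp add: Sr[OF order_refl, symmetric])
    show "P.random_variable borel (p t)" for t
      using meas[of "p t" borel t] unfolding p_def by (simp add: Sr[OF order_refl, symmetric])
    show "AE \<omega> in P. p 0 \<omega> = p0 \<and> (\<forall>h\<in>{1..g}. G h 0 \<omega> = N0 h)"
      by (simp add: p_def G_def S_def)
  next
    fix t \<nu> \<pi> h
    assume h: "h \<in> {1..g}" and pos: "\<P>(\<omega> in P. has_history g G p t \<nu> \<pi> \<omega>) > 0"
    from pos_ex[OF pos] obtain w where w: "has_history g G p t \<nu> \<pi> w" by blast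
    have iff: "active_step g f G p h t \<omega> \<longleftrightarrow> \<omega> t \<in> block (\<lambda>j. \<nu> j t) h"
      if "has_history g G p t \<nu> \<pi> \<omega>" for \<omega>
    proof -
      have "block (\<lambda>j. \<nu> j t) h = block (fst (S t \<omega>)) h"
        using that h by (intro block_cong) (auto simp: has_history_def G_def)
      thus ?thesis using choice_step_active_iff[OF h, of f "S t \<omega>" "\<omega> t"]
        by (simp add: active_step_def G_def p_def S_def)
    qed
    have "\<P>(\<omega> in P. active_step g f G p h t \<omega> \<bar> has_history g G p t \<nu> \<pi> \<omega>) =
        U.prob (block (\<lambda>j. \<nu> j t) h)"
      by (rule cond[OF pos]) (rule iff)
    also have "\<dots> = real (\<nu> h t) / real N"
    proof (subst probU)
      have "block (\<lambda>j. \<nu> j t) h \<subseteq> (\<Union>h\<in>{1..g}. block (\<lambda>j. \<nu> j t) h)" using h by blast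
      also have "\<dots> = {..<\<Sum>h=1..g. \<nu> h t}" by (rule Union_block)
      also have "\<dots> \<subseteq> {..<N}" using le[of t w] w by (auto simp: has_history_def)
      finally show "block (\<lambda>j. \<nu> j t) h \<subseteq> {..<N}" .
    qed (use h card_block in auto)
    finally show "\<P>(\<omega> in P. active_step g f G p h t \<omega> \<bar> has_history g G p t \<nu> \<pi> \<omega>) =
        real (\<nu> h t) / real N" .
  next
    fix t \<nu> \<pi>
    assume pos: "\<P>(\<omega> in P. has_history g G p t \<nu> \<pi> \<omega>) > 0"
    from pos_ex[OF pos] obtain w where w: "has_history g G p t \<nu> \<pi> w" by blast
    let ?s = "\<Sum>h=1..g. \<nu> h t"
    have sN: "?s \<le> N" using le[of t w] w by (auto simp: has_history_def)
    have iff: "inactive_step g G p t \<omega> \<longleftrightarrow> \<omega> t \<in> - {..<?s}"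
      if "has_history g G p t \<nu> \<pi> \<omega>" for \<omega>
    proof -
      have "?s = (\<Sum>h=1..g. fst (S t \<omega>) h)"
        using that by (intro sum.cong) (auto simp: has_history_def G_def)
      thus ?thesis using choice_step_inactive_iff[where f = f and g = g and s = "S t \<omega>" and i = "\<omega> t"]
        by (simp add: inactive_step_def G_def p_def S_def not_less)
    qed
    have "\<P>(\<omega> in P. inactive_step g G p t \<omega> \<bar> has_history g G p t \<nu> \<pi> \<omega>) =
        U.prob (- {..<?s})"
      by (rule cond[OF pos]) (rule iff)
    also have "\<dots> = 1 - U.prob {..<?s}"
      using U.prob_compl[of "{..<?s}"] by (simp add: spU Compl_eq_Diff_UNIV)
    also have "\<dots> = 1 - real ?s / real N" using sN by (subst probU) auto
    also have "\<dots> = (real N - (\<Sum>h=1..g. real (\<nu> h t))) / real N"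
      using assms(2) by (simp add: field_simps)
    finally show "\<P>(\<omega> in P. inactive_step g G p t \<omega> \<bar> has_history g G p t \<nu> \<pi> \<omega>) =
        (real N - (\<Sum>h=1..g. real (\<nu> h t))) / real N" .
  qed (use assms in auto)
qed


section \<open>Moments, cumulants and parameters\<close>

definition v1 :: "nat \<Rightarrow> (nat \<Rightarrow> real) \<Rightarrow> real \<Rightarrow> real" where
  "v1 g m x = 1 + (\<Sum>k=1..2*g. m k / fact k * x ^ k)"

definition kappa :: "nat \<Rightarrow> (nat \<Rightarrow> real) \<Rightarrow> nat \<Rightarrow> real" where
  "kappa g m n = (deriv ^^ n) (\<lambda>x. ln (v1 g m x)) 0"

text \<open>The matrices with entries \<open>\<kappa>\<^sub>i\<^sub>+\<^sub>j\<^sub>-\<^sub>1\<close> and \<open>\<kappa>\<^sub>i\<^sub>+\<^sub>j\<close> on paper have index sums shifted by 1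
  and 2.\<close>

definition hankel :: "nat \<Rightarrow> (nat \<Rightarrow> real) \<Rightarrow> nat \<Rightarrow> real mat" where
  "hankel g m s = Matrix.mat g g (\<lambda>(i, j). kappa g m (i + j + s))"

definition q_poly :: "nat \<Rightarrow> (nat \<Rightarrow> real) \<Rightarrow> real poly" where
  "q_poly g m = Determinant.det
     ([:0, 1:] \<cdot>\<^sub>m map_mat (\<lambda>c. [:c:]) (hankel g m 1) - map_mat (\<lambda>c. [:c:]) (hankel g m 2))"

definition vandermonde :: "nat \<Rightarrow> (nat \<Rightarrow> real) \<Rightarrow> real mat" where
  "vandermonde g r = Matrix.mat g g (\<lambda>(i, j). r (Suc i) ^ j)"

definition diag_roots :: "nat \<Rightarrow> (nat \<Rightarrow> real) \<Rightarrow> real mat" where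
  "diag_roots g r = Matrix.mat g g (\<lambda>(i, j). if i = j then r (Suc i) else 0)"

definition lambda_vec :: "nat \<Rightarrow> (nat \<Rightarrow> real) \<Rightarrow> (nat \<Rightarrow> real) \<Rightarrow> real vec" where
  "lambda_vec g m r =
     the (mat_inverse (diag_roots g r)) *\<^sub>v
       (the (mat_inverse (transpose_mat (vandermonde g r))) *\<^sub>v
         Matrix.vec g (\<lambda>i. kappa g m (Suc i)))"

definition lam :: "nat \<Rightarrow> (nat \<Rightarrow> real) \<Rightarrow> (nat \<Rightarrow> real) \<Rightarrow> nat \<Rightarrow> real" where
  "lam g m r h = vec_index (lambda_vec g m r) (h - 1)"

definition init_size :: "nat \<Rightarrow> (nat \<Rightarrow> real) \<Rightarrow> (nat \<Rightarrow> real) \<Rightarrow> real \<Rightarrow> nat \<Rightarrow> nat" where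
  "init_size g m r C h = nat \<lfloor>lam g m r h * C\<rfloor>"

definition falling_fact :: "nat \<Rightarrow> nat \<Rightarrow> real" where
  "falling_fact a l = (\<Prod>i<l. real a - real i)"

definition mu :: "nat \<Rightarrow> (nat \<Rightarrow> real) \<Rightarrow> (nat \<Rightarrow> real) \<Rightarrow> real \<Rightarrow> nat \<Rightarrow> real" where
  "mu g m r C n =
     (\<Sum>ns | ns \<in> {1..g} \<rightarrow>\<^sub>E UNIV \<and> (\<Sum>h=1..g. ns h) = n.
        fact n / (\<Prod>h=1..g. fact (ns h)) * (\<Prod>h=1..g. r h ^ ns h) *
        (\<Sum>ks \<in> (\<Pi>\<^sub>E h\<in>{1..g}. {0..ns h}).
           (\<Prod>h=1..g. falling_fact (init_size g m r C h) (ks h) * real (Stirling (ns h) (ks h))) *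
           C powi (- int (\<Sum>h=1..g. ks h))))"

definition obs_time :: "real \<Rightarrow> nat \<Rightarrow> nat" where
  "obs_time C N = nat \<lfloor>- real N * ln (1 - 1 / C)\<rfloor>"

end

theory Submission
  imports Defs "HOL-Real_Asymp.Real_Asymp"
begin

text \<open>The group sizes form a Markov chain, and the factorial moments of the numbers of chosen
  investors solve a closed linear recursion; \<open>k\<close> given investors have all been chosen by
  time \<open>t\<close> with a probability that tends to \<open>C\<^sup>-\<^sup>k\<close> for \<open>N \<rightarrow> \<infinity>\<close>. Expanding
  powers in falling factorials, the moments of the log-return therefore converge to \<open>\<mu>(C, n)\<close>.
  For \<open>C \<rightarrow> \<infinity>\<close> the latter converge to the moments of \<open>\<Sum> r\<^sub>h X\<^sub>h\<close> with independent
  Poisson variables \<open>X\<^sub>h\<close> of means \<open>\<lambda>\<^sub>h\<close>, whose cumulants are \<open>\<Sum> \<lambda>\<^sub>h r\<^sub>h\<^sup>n\<close>.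
  These equal \<open>\<kappa>\<^sub>n\<close>: for \<open>n \<le> g\<close> by the choice of \<open>\<lambda>\<close>, and up to \<open>2g\<close> because
  both sequences satisfy the recurrence with characteristic polynomial proportional to \<open>q\<close>.\<close>

section \<open>Stirling numbers and Poisson generating functions\<close>

lemma falling_fact_Suc: "falling_fact a (Suc k) = falling_fact a k * (real a - real k)"
  by (simp add: falling_fact_def)

text \<open>Induction on \<open>n\<close>: the identity a (a)_k = (a)_(k+1) + k (a)_k turns one more
  factor a into the two terms of the Stirling recurrence.\<close>

lemma of_nat_power_eq_sum_Stirling:
  "real a ^ n = (\<Sum>k=0..n. real (Stirling n k) * falling_fact a k)"
proof (induction n)
  case 0
  show ?case by (simp add: falling_fact_def)
next
  case (Suc n)
  have "real a ^ Suc n = (\<Sum>k=0..n. real (Stirling n k) * (real a * falling_fact a k))"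
    by (simp add: Suc sum_distrib_left algebra_simps)
  also have "\<dots> = (\<Sum>k=0..n. real (Stirling n k) * falling_fact a (Suc k)) +
      (\<Sum>k=0..n. real (k * Stirling n k) * falling_fact a k)"
    by (simp add: falling_fact_Suc sum.distrib[symmetric] algebra_simps)
  \<comment> \<open>The index range may be changed at both ends: \<open>Stirling n (Suc n)\<close>
    is 0, and the factor \<open>k\<close> kills the term at 0.\<close>
  also have "(\<Sum>k=0..n. real (k * Stirling n k) * falling_fact a k) =
      (\<Sum>k=0..Suc n. real (k * Stirling n k) * falling_fact a k)"
    by simp
  also have "\<dots> = (\<Sum>k=0..n. real (Suc k * Stirling n (Suc k)) * falling_fact a (Suc k))"
    by (subst sum.atLeast0_atMost_Suc_shift) (simp del: of_nat_Suc mult_Suc)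
  also have "(\<Sum>k=0..n. real (Stirling n k) * falling_fact a (Suc k)) + \<dots> =
      (\<Sum>k=0..n. real (Stirling (Suc n) (Suc k)) * falling_fact a (Suc k))"
    by (simp add: sum.distrib[symmetric] algebra_simps)
  also have "\<dots> = (\<Sum>k=0..Suc n. real (Stirling (Suc n) k) * falling_fact a k)"
    using sum.atLeast0_atMost_Suc_shift[of "\<lambda>k. real (Stirling (Suc n) k) * falling_fact a k" n]
    by (simp del: sum.atLeast0_atMost_Suc Stirling.simps(4))
  finally show ?case .
qed

text \<open>Combinatorially, \<open>j\<close> counts the elements outside the block of a fixed
  element, and the other \<open>k\<close> blocks partition these. The induction rests on Pascal's
  rule.\<close>

lemma Stirling_Suc_Suc_eq_sum_binomial:
  "Stirling (Suc n) (Suc k) = (\<Sum>j\<le>n. (n choose j) * Stirling j k)"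
proof (induction n arbitrary: k)
  case 0
  show ?case by (cases k) auto
next
  case (Suc n)
  have "(\<Sum>j\<le>Suc n. (Suc n choose j) * Stirling j k) =
      Stirling 0 k + (\<Sum>j\<le>n. (Suc n choose Suc j) * Stirling (Suc j) k)"
    by (subst sum.atMost_Suc_shift) simp
  also have "\<dots> = (Stirling 0 k + (\<Sum>j\<le>n. (n choose Suc j) * Stirling (Suc j) k)) +
      (\<Sum>j\<le>n. (n choose j) * Stirling (Suc j) k)"
    by (simp add: sum.distrib algebra_simps)
  also have "Stirling 0 k + (\<Sum>j\<le>n. (n choose Suc j) * Stirling (Suc j) k) =
      (\<Sum>j\<le>Suc n. (n choose j) * Stirling j k)"
    by (subst sum.atMost_Suc_shift) simp
  also have "\<dots> = Stirling (Suc n) (Suc k)"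
    using Suc.IH[of k] by simp
  also have "(\<Sum>j\<le>n. (n choose j) * Stirling (Suc j) k) =
      k * Stirling (Suc n) (Suc k) + Stirling (Suc n) k"
  proof (cases k)
    \<comment> \<open>The Stirling recurrence splits the sum into two of the same shape, covered by
      the induction hypothesis at \<open>k\<close> and at \<open>l\<close>.\<close>
    case (Suc l)
    have "(\<Sum>j\<le>n. (n choose j) * Stirling (Suc j) (Suc l)) =
        Suc l * (\<Sum>j\<le>n. (n choose j) * Stirling j (Suc l)) + (\<Sum>j\<le>n. (n choose j) * Stirling j l)"
      by (simp add: sum.distrib[symmetric] sum_distrib_left algebra_simps)
    thus ?thesis by (simp only: Suc.IH[of k, unfolded Suc] Suc.IH[of l] Suc)
  qed simp
  finally show ?case by simp
qed

text \<open>The Touchard polynomial, that is the \<open>n\<close>-th moment of a Poisson variable of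
  mean \<open>x\<close>.\<close>

definition touchard :: "real \<Rightarrow> nat \<Rightarrow> real" where
  "touchard x n = (\<Sum>k=0..n. real (Stirling n k) * x ^ k)"

text \<open>Recasts the moments as a convolution, so that their exponential generating function
  satisfies a linear differential equation.\<close>

lemma touchard_Suc: "touchard x (Suc n) = x * (\<Sum>j\<le>n. real (n choose j) * touchard x j)"
proof -
  have "touchard x (Suc n) = (\<Sum>k=0..n. real (Stirling (Suc n) (Suc k)) * x ^ Suc k)"
    unfolding touchard_def by (subst sum.atLeast0_atMost_Suc_shift) simp
  also have "\<dots> = x * (\<Sum>k=0..n. \<Sum>j\<le>n. real (n choose j) * real (Stirling j k) * x ^ k)"
    unfolding Stirling_Suc_Suc_eq_sum_binomial
    by (simp add: sum_distrib_left sum_distrib_right algebra_simps)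
  also have "(\<Sum>k=0..n. \<Sum>j\<le>n. real (n choose j) * real (Stirling j k) * x ^ k) =
      (\<Sum>j\<le>n. \<Sum>k=0..n. real (n choose j) * real (Stirling j k) * x ^ k)"
    by (rule sum.swap)
  also have "\<dots> = (\<Sum>j\<le>n. real (n choose j) * touchard x j)"
  proof (rule sum.cong[OF refl])
    fix j assume "j \<in> {..n}"
    \<comment> \<open>\<open>Stirling j k\<close> vanishes for \<open>k > j\<close>, which cuts the
      sum down to the range of \<open>touchard x j\<close>.\<close>
    hence "(\<Sum>k=0..n. real (n choose j) * real (Stirling j k) * x ^ k) =
        (\<Sum>k=0..j. real (n choose j) * real (Stirling j k) * x ^ k)"
      by (intro sum.mono_neutral_right) auto
    thus "(\<Sum>k=0..n. real (n choose j) * real (Stirling j k) * x ^ k) =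
        real (n choose j) * touchard x j"
      by (simp add: touchard_def sum_distrib_left mult.assoc)
  qed
  finally show ?thesis .
qed

text \<open>The exponential moment generating function of \<open>r\<close> times a Poisson variable of mean \<open>l\<close>.\<close>

definition poisson_fps :: "real \<Rightarrow> real \<Rightarrow> real fps" where
  "poisson_fps l r = Abs_fps (\<lambda>n. r ^ n * touchard l n / fact n)"

text \<open>The equation F' = l r exp(r X) F is that of exp(l (exp(r X) - 1)). It shows the
  cumulants l r^n in the logarithmic derivative without forming a logarithm of power series.\<close>

lemma fps_deriv_poisson_fps:
  "fps_deriv (poisson_fps l r) = fps_const (l * r) * fps_exp r * poisson_fps l r"
proof (rule fps_ext)
  fix n
  have "fps_nth (fps_deriv (poisson_fps l r)) n = r ^ Suc n * touchard l (Suc n) / fact n"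
    by (simp add: poisson_fps_def field_simps del: of_nat_Suc)
  also have "\<dots> = l * r * (\<Sum>j\<le>n. r ^ n * (real (n choose j) / fact n) * touchard l j)"
    by (simp add: touchard_Suc sum_distrib_left sum_divide_distrib algebra_simps)
  also have "\<dots> = l * r * (\<Sum>j\<le>n. (r ^ j * touchard l j / fact j) * (r ^ (n - j) / fact (n - j)))"
  proof (intro arg_cong[where f = "(*) (l * r)"] sum.cong refl)
    fix j assume "j \<in> {..n}"
    thus "r ^ n * (real (n choose j) / fact n) * touchard l j =
        (r ^ j * touchard l j / fact j) * (r ^ (n - j) / fact (n - j))"
      using power_add[of r j "n - j"] by (simp add: binomial_fact)
  qed
  also have "\<dots> = fps_nth (fps_const (l * r) * fps_exp r * poisson_fps l r) n"
    by (subst mult.assoc, subst mult.commute[of "fps_exp r"], subst fps_mult_left_const_nth,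
        subst fps_mult_nth) (simp add: poisson_fps_def atLeast0AtMost)
  finally show "fps_nth (fps_deriv (poisson_fps l r)) n =
      fps_nth (fps_const (l * r) * fps_exp r * poisson_fps l r) n" .
qed

text \<open>Logarithmic derivatives add up over a product; for generating functions of independent
  variables this is the additivity of cumulants.\<close>

lemma fps_deriv_prod_log:
  assumes "finite A" "\<And>h. h \<in> A \<Longrightarrow> fps_deriv (F h) = L h * F h"
  shows "fps_deriv (\<Prod>h\<in>A. F h) = (\<Sum>h\<in>A. L h) * (\<Prod>h\<in>A. F h :: 'a :: comm_ring_1 fps)"
  using assms by (induction rule: finite_induct) (auto simp: algebra_simps)

section \<open>Coefficients of products of power series and the multinomial theorem\<close>

lemma finite_PiE_sum_eq:
  assumes "finite A"
  shows "finite {ns. ns \<in> A \<rightarrow>\<^sub>E UNIV \<and> (\<Sum>h\<in>A. ns h) = (n :: nat)}"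
proof (rule finite_subset)
  show "{ns. ns \<in> A \<rightarrow>\<^sub>E UNIV \<and> (\<Sum>h\<in>A. ns h) = n} \<subseteq> A \<rightarrow>\<^sub>E {..n}"
  proof (clarsimp simp: PiE_iff)
    fix ns :: "'a \<Rightarrow> nat" and h assume "h \<in> A"
    thus "ns h \<le> sum ns A" using assms by (intro member_le_sum) auto
  qed
  show "finite (A \<rightarrow>\<^sub>E {..n})" using assms by (intro finite_PiE) auto
qed

lemma fps_nth_prod_PiE:
  fixes F :: "'b \<Rightarrow> 'a :: comm_ring_1 fps"
  assumes "finite A"
  shows "fps_nth (\<Prod>h\<in>A. F h) n =
    (\<Sum>ns | ns \<in> A \<rightarrow>\<^sub>E UNIV \<and> (\<Sum>h\<in>A. ns h) = n. \<Prod>h\<in>A. fps_nth (F h) (ns h))"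
  using assms
proof (induction arbitrary: n rule: finite_induct)
  case empty
  show ?case by (cases n) (auto simp: PiE_empty_domain)
next
  case (insert a A)
  let ?W = "\<lambda>A n. {ns. ns \<in> A \<rightarrow>\<^sub>E UNIV \<and> (\<Sum>h\<in>A. ns h) = n}"
  have "fps_nth (\<Prod>h\<in>insert a A. F h) n =
      (\<Sum>i=0..n. \<Sum>ns\<in>?W A (n - i). fps_nth (F a) i * (\<Prod>h\<in>A. fps_nth (F h) (ns h)))"
    using insert by (simp add: fps_mult_nth sum_distrib_left)
  also have "\<dots> = (\<Sum>(i, ns)\<in>(SIGMA i:{0..n}. ?W A (n - i)).
      fps_nth (F a) i * (\<Prod>h\<in>A. fps_nth (F h) (ns h)))"
    using insert(1) by (subst sum.Sigma) (auto intro: finite_PiE_sum_eq)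
  also have "\<dots> = (\<Sum>ns\<in>?W (insert a A) n. \<Prod>h\<in>insert a A. fps_nth (F h) (ns h))"
  \<comment> \<open>A vector on \<open>insert a A\<close> is the pair of its value at
    \<open>a\<close> and the rest; resetting the rest to \<open>undefined\<close> at
    \<open>a\<close> keeps it extensional.\<close>
  proof (rule sum.reindex_bij_witness[where i = "\<lambda>ns. (ns a, ns(a := undefined))"
        and j = "\<lambda>(i, ns). ns(a := i)"])
    fix x assume x: "x \<in> (SIGMA i:{0..n}. ?W A (n - i))"
    obtain i ns where [simp]: "x = (i, ns)" by (cases x)
    have ns: "i \<le> n" "ns \<in> A \<rightarrow>\<^sub>E UNIV" "(\<Sum>h\<in>A. ns h) = n - i" using x by auto
    have "ns a = undefined" using ns insert(2) by (auto simp: PiE_iff extensional_def)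
    thus "((case x of (i, ns) \<Rightarrow> ns(a := i)) a, (case x of (i, ns) \<Rightarrow> ns(a := i))(a := undefined)) = x"
      by auto
    have s: "(\<Sum>h\<in>A. (ns(a := i)) h) = (\<Sum>h\<in>A. ns h)"
      using insert(2) by (intro sum.cong) auto
    show "(case x of (i, ns) \<Rightarrow> ns(a := i)) \<in> ?W (insert a A) n"
      using ns insert(1,2) s by (auto simp: PiE_iff extensional_def)
    have "(\<Prod>h\<in>A. fps_nth (F h) ((ns(a := i)) h)) = (\<Prod>h\<in>A. fps_nth (F h) (ns h))"
      using insert(2) by (intro prod.cong) auto
    thus "(\<Prod>h\<in>insert a A. fps_nth (F h) ((case x of (i, ns) \<Rightarrow> ns(a := i)) h)) =
        (case x of (i, ns) \<Rightarrow> fps_nth (F a) i * (\<Prod>h\<in>A. fps_nth (F h) (ns h)))"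
      using insert(1,2) by simp
  next
    fix ns assume ns: "ns \<in> ?W (insert a A) n"
    have s: "(\<Sum>h\<in>A. (ns(a := undefined)) h) = (\<Sum>h\<in>A. ns h)"
      using insert(2) by (intro sum.cong) auto
    show "(case (ns a, ns(a := undefined)) of (i, ns) \<Rightarrow> ns(a := i)) = ns" by simp
    show "(ns a, ns(a := undefined)) \<in> (SIGMA i:{0..n}. ?W A (n - i))"
      using ns insert(1,2) s by (auto simp: PiE_iff extensional_def)
  qed
  finally show ?case .
qed

lemma fps_exp_sum:
  "finite A \<Longrightarrow> fps_exp (\<Sum>h\<in>A. a h :: 'a :: field_char_0) = (\<Prod>h\<in>A. fps_exp (a h))"
  by (induction rule: finite_induct) (auto simp: fps_exp_add_mult)

text \<open>Compares the coefficients of order \<open>n\<close> in the exponential of a sum and in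
  the product of exponentials.\<close>

lemma power_sum_multinomial:
  fixes a :: "'b \<Rightarrow> real"
  assumes "finite A"
  shows "(\<Sum>h\<in>A. a h) ^ n = (\<Sum>ns | ns \<in> A \<rightarrow>\<^sub>E UNIV \<and> (\<Sum>h\<in>A. ns h) = n.
     fact n / (\<Prod>h\<in>A. real (fact (ns h))) * (\<Prod>h\<in>A. a h ^ ns h))"
proof -
  have "(\<Sum>h\<in>A. a h) ^ n = fact n * fps_nth (fps_exp (\<Sum>h\<in>A. a h)) n" by simp
  also have "fps_nth (fps_exp (\<Sum>h\<in>A. a h)) n =
      (\<Sum>ns | ns \<in> A \<rightarrow>\<^sub>E UNIV \<and> (\<Sum>h\<in>A. ns h) = n. \<Prod>h\<in>A. a h ^ ns h / real (fact (ns h)))"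
    using assms by (simp only: fps_exp_sum fps_nth_prod_PiE fps_exp_nth)
  finally show ?thesis
    by (simp add: sum_distrib_left prod_dividef)
qed

text \<open>The common shape of \<open>mu\<close> and of the exact moments of the log-return: only
  the weight \<open>c\<close> of the total order differs, a power of C in the former and
  \<open>hit_coeff\<close> in the latter.\<close>

definition moment_form :: "nat \<Rightarrow> (nat \<Rightarrow> nat) \<Rightarrow> (nat \<Rightarrow> real) \<Rightarrow> nat \<Rightarrow> (nat \<Rightarrow> real) \<Rightarrow> real" where
  "moment_form g a r n c =
     (\<Sum>ns | ns \<in> {1..g} \<rightarrow>\<^sub>E UNIV \<and> (\<Sum>h=1..g. ns h) = n.
        fact n / (\<Prod>h=1..g. fact (ns h)) * (\<Prod>h=1..g. r h ^ ns h) *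
        (\<Sum>ks \<in> (\<Pi>\<^sub>E h\<in>{1..g}. {0..ns h}).
           (\<Prod>h=1..g. falling_fact (a h) (ks h) * real (Stirling (ns h) (ks h))) *
           c (\<Sum>h=1..g. ks h)))"

section \<open>The Poisson limit of \<open>mu\<close>\<close>

lemma mu_eq_moment_form:
  "mu g m r C n = moment_form g (init_size g m r C) r n (\<lambda>k. C powi (- int k))"
  by (simp add: mu_def moment_form_def)

text \<open>Each of the \<open>k\<close> factors, divided by its own copy of C, tends to
  \<open>l\<close>.\<close>

lemma falling_fact_floor_tendsto:
  assumes "0 < l"
  shows "((\<lambda>C. falling_fact (nat \<lfloor>l * C\<rfloor>) k * C powi (- int k)) \<longlongrightarrow> l ^ k) at_top"
proof -
  have "((\<lambda>C. \<Prod>i<k. (real (nat \<lfloor>l * C\<rfloor>) - real i) / C) \<longlongrightarrow> (\<Prod>i<k. l)) at_top"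
  proof (rule tendsto_prod)
    fix i
    have "((\<lambda>C. (of_int \<lfloor>l * C\<rfloor> - real i) / C) \<longlongrightarrow> l) at_top"
      using assms by real_asymp
    \<comment> \<open>For C >= 0 the floor is nonnegative, so \<open>nat\<close> does not
      truncate.\<close>
    moreover have "\<forall>\<^sub>F C in at_top.
        (of_int \<lfloor>l * C\<rfloor> - real i) / C = (real (nat \<lfloor>l * C\<rfloor>) - real i) / C"
      using eventually_ge_at_top[of 0] by eventually_elim (use assms in simp)
    ultimately show "((\<lambda>C. (real (nat \<lfloor>l * C\<rfloor>) - real i) / C) \<longlongrightarrow> l) at_top"
      by (rule Lim_transform_eventually)
  qed
  moreover have "(\<Prod>i<k. (real a - real i) / C) = falling_fact a k * C powi (- int k)" for a C
    unfolding prod_dividef by (simp add: falling_fact_def power_int_minus divide_inverse)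
  ultimately show ?thesis by simp
qed

text \<open>The power of C splits over the groups, so every falling factorial is normalised
  separately and tends to a power of \<open>l h\<close>. What remains are Touchard polynomials,
  hence coefficients of \<open>poisson_fps\<close>.\<close>

lemma moment_form_tendsto_poisson:
  fixes a :: "real \<Rightarrow> nat \<Rightarrow> nat"
  assumes "\<And>h k. h \<in> {1..g} \<Longrightarrow>
    ((\<lambda>C. falling_fact (a C h) k * C powi (- int k)) \<longlongrightarrow> l h ^ k) at_top"
  shows "((\<lambda>C. moment_form g (a C) r n (\<lambda>k. C powi (- int k))) \<longlongrightarrow>
    fact n * fps_nth (\<Prod>h=1..g. poisson_fps (l h) (r h)) n) at_top"
proof -
  have powi_sum: "C powi (- int (\<Sum>h=1..g. ks h)) = (\<Prod>h=1..g. C powi (- int (ks h)))"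
    for C :: real and ks :: "nat \<Rightarrow> nat"
    by (simp add: power_int_minus power_sum prod_inversef[symmetric] del: power_inverse of_nat_sum)
  have "((\<lambda>C. moment_form g (a C) r n (\<lambda>k. C powi (- int k))) \<longlongrightarrow>
     (\<Sum>ns | ns \<in> {1..g} \<rightarrow>\<^sub>E UNIV \<and> (\<Sum>h=1..g. ns h) = n.
        fact n / (\<Prod>h=1..g. fact (ns h)) * (\<Prod>h=1..g. r h ^ ns h) *
        (\<Sum>ks \<in> (\<Pi>\<^sub>E h\<in>{1..g}. {0..ns h}).
           (\<Prod>h=1..g. l h ^ ks h * real (Stirling (ns h) (ks h)))))) at_top"
    unfolding moment_form_def powi_sum prod.distrib[symmetric]
  proof (intro tendsto_sum tendsto_mult_left tendsto_prod)
    fix ks :: "nat \<Rightarrow> nat" and ns h assume "h \<in> {1..g}"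
    from tendsto_mult[OF assms[OF this, of "ks h"] tendsto_const[of "real (Stirling (ns h) (ks h))"]]
    show "((\<lambda>C. falling_fact (a C h) (ks h) * real (Stirling (ns h) (ks h)) * C powi (- int (ks h)))
        \<longlongrightarrow> l h ^ ks h * real (Stirling (ns h) (ks h))) at_top"
      by (simp add: mult_ac)
  qed
  also have "(\<lambda>ns. \<Sum>ks \<in> (\<Pi>\<^sub>E h\<in>{1..g}. {0..ns h}).
      (\<Prod>h=1..g. l h ^ ks h * real (Stirling (ns h) (ks h)))) =
      (\<lambda>ns. \<Prod>h=1..g. touchard (l h) (ns h))"
    by (simp add: touchard_def prod_sum_PiE mult.commute)
  also have "(\<Sum>ns | ns \<in> {1..g} \<rightarrow>\<^sub>E UNIV \<and> (\<Sum>h=1..g. ns h) = n.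
        fact n / (\<Prod>h=1..g. fact (ns h)) * (\<Prod>h=1..g. r h ^ ns h) *
        (\<Prod>h=1..g. touchard (l h) (ns h))) =
      fact n * fps_nth (\<Prod>h=1..g. poisson_fps (l h) (r h)) n"
    by (subst fps_nth_prod_PiE)
      (simp_all add: poisson_fps_def sum_distrib_left prod_dividef prod.distrib mult.assoc)
  finally show ?thesis .
qed

section \<open>Moments and cumulants\<close>

lemma higher_deriv_conv_fps_nth:
  fixes f :: "real \<Rightarrow> real"
  assumes "f has_fps_expansion F"
  shows "(deriv ^^ n) f 0 = fact n * fps_nth F n"
proof -
  have "(deriv ^^ n) f has_fps_expansion (fps_deriv ^^ n) F"
    by (induction n) (auto intro: assms has_fps_expansion_deriv)
  hence "(deriv ^^ n) f 0 = fps_nth ((fps_deriv ^^ n) F) 0"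
    by (auto simp: has_fps_expansion_def eval_fps_at_0 dest: eventually_nhds_x_imp_x)
  also have "\<dots> = fact n * fps_nth F n"
    by (rule fps_0th_higher_deriv)
  finally show ?thesis .
qed

definition v1_fps :: "nat \<Rightarrow> (nat \<Rightarrow> real) \<Rightarrow> real fps" where
  "v1_fps g m = 1 + (\<Sum>k=1..2*g. fps_const (m k / fact k) * fps_X ^ k)"

lemma fps_nth_v1_fps:
  "fps_nth (v1_fps g m) n = (if n = 0 then 1 else if n \<le> 2 * g then m n / fact n else 0)"
  by (auto simp: v1_fps_def fps_sum_nth if_distrib[of "\<lambda>x. _ * x"] cong: if_cong)

lemma v1_has_fps_expansion: "v1 g m has_fps_expansion v1_fps g m"
  unfolding v1_def v1_fps_def by (intro fps_expansion_intros)

text \<open>The first derivative of ln v1 is v1'/v1, so the cumulants come from a quotient of power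
  series; the derivative already taken shifts the index by 1.\<close>

lemma kappa_conv_fps_nth:
  "kappa g m (Suc k) = fact k * fps_nth (fps_deriv (v1_fps g m) / v1_fps g m) k"
proof -
  let ?v = "v1 g m"
  have "(\<lambda>x. deriv ?v x / ?v x) has_fps_expansion fps_deriv (v1_fps g m) / v1_fps g m"
    by (intro has_fps_expansion_divide' has_fps_expansion_deriv v1_has_fps_expansion)
      (simp add: fps_nth_v1_fps)
  \<comment> \<open>Agreement where \<open>v1\<close> is positive suffices: its value at 0 is 1, and
    an expansion depends only on the function near 0.\<close>
  moreover have "\<forall>\<^sub>F x in nhds 0. deriv ?v x / ?v x = deriv (\<lambda>x. ln (?v x)) x"
  proof -
    have v': "(?v has_real_derivative deriv ?v x) (at x)" for x
      unfolding DERIV_deriv_iff_real_differentiable v1_def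
      by (intro derivative_intros differentiable_sum) auto
    have "isCont ?v 0" using v' by (rule DERIV_isCont)
    moreover have "?v 0 = 1" by (simp add: v1_def power_0_left)
    ultimately have "\<forall>\<^sub>F x in nhds 0. ?v x > 0"
      using tendsto_at_iff_tendsto_nhds[of ?v 0] by (intro order_tendstoD(1)[of ?v 1]) (auto simp: isCont_def)
    thus ?thesis
    proof eventually_elim
      case (elim x)
      have "((\<lambda>x. ln (?v x)) has_real_derivative deriv ?v x / ?v x) (at x)"
        using elim by (auto intro!: derivative_eq_intros v')
      thus ?case by (rule DERIV_imp_deriv[symmetric])
    qed
  qed
  ultimately have "deriv (\<lambda>x. ln (?v x)) has_fps_expansion fps_deriv (v1_fps g m) / v1_fps g m"
    unfolding has_fps_expansion_def by (auto elim: eventually_elim2)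
  from higher_deriv_conv_fps_nth[OF this, of k] show ?thesis
    by (simp add: kappa_def funpow_Suc_right del: funpow.simps)
qed

lemma fps_nth_0_prod:
  "fps_nth (\<Prod>h\<in>A. F h :: 'a :: comm_ring_1 fps) 0 = (\<Prod>h\<in>A. fps_nth (F h) 0)"
  by (induction A rule: infinite_finite_induct) auto

text \<open>Comparing coefficients in F' = A F expresses the coefficient \<open>n\<close> of F
  through its earlier ones and those of A below \<open>n\<close>.\<close>

lemma fps_nth_eq_if_log_deriv_eq:
  fixes F G :: "'a :: field_char_0 fps"
  assumes "fps_deriv F = A * F" "fps_deriv G = B * G" "fps_nth F 0 = fps_nth G 0"
    and "\<And>k. k < M \<Longrightarrow> fps_nth A k = fps_nth B k" and "n \<le> M"
  shows "fps_nth F n = fps_nth G n"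
  using \<open>n \<le> M\<close>
proof (induction n rule: less_induct)
  case (less n)
  show ?case
  proof (cases n)
    case 0
    thus ?thesis using assms(3) by simp
  next
    case (Suc k)
    have "of_nat (Suc k) * fps_nth F (Suc k) = (\<Sum>i=0..k. fps_nth A i * fps_nth F (k - i))"
      using arg_cong[OF assms(1), of "\<lambda>f. fps_nth f k"] by (simp add: fps_mult_nth)
    also have "\<dots> = (\<Sum>i=0..k. fps_nth B i * fps_nth G (k - i))"
      using less Suc by (intro sum.cong refl arg_cong2[where f = "(*)"] assms(4)) auto
    also have "\<dots> = of_nat (Suc k) * fps_nth G (Suc k)"
      using arg_cong[OF assms(2), of "\<lambda>f. fps_nth f k"] by (simp add: fps_mult_nth)
    finally show ?thesis using Suc by (simp del: of_nat_Suc)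
  qed
qed

text \<open>Equal cumulants up to order 2g mean equal logarithmic derivatives below order 2g, and
  this transfers to the moments stored in \<open>v1_fps\<close>.\<close>

lemma poisson_moment_eq:
  assumes "\<And>n. n \<in> {1..2*g} \<Longrightarrow> kappa g m n = (\<Sum>h=1..g. l h * r h ^ n)" and "n \<in> {1..2*g}"
  shows "fact n * fps_nth (\<Prod>h=1..g. poisson_fps (l h) (r h)) n = m n"
proof -
  have "fps_nth (\<Prod>h=1..g. poisson_fps (l h) (r h)) n = fps_nth (v1_fps g m) n"
  proof (rule fps_nth_eq_if_log_deriv_eq)
    show "fps_deriv (\<Prod>h=1..g. poisson_fps (l h) (r h)) =
        (\<Sum>h=1..g. fps_const (l h * r h) * fps_exp (r h)) * (\<Prod>h=1..g. poisson_fps (l h) (r h))"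
      by (rule fps_deriv_prod_log) (auto simp: fps_deriv_poisson_fps)
    show "fps_deriv (v1_fps g m) = fps_deriv (v1_fps g m) / v1_fps g m * v1_fps g m"
      by (simp add: fps_divide_unit mult.assoc inverse_mult_eq_1 fps_nth_v1_fps)
    show "fps_nth (\<Prod>h=1..g. poisson_fps (l h) (r h)) 0 = fps_nth (v1_fps g m) 0"
      by (simp add: fps_nth_0_prod fps_nth_v1_fps poisson_fps_def touchard_def)
    show "fps_nth (\<Sum>h=1..g. fps_const (l h * r h) * fps_exp (r h)) k =
        fps_nth (fps_deriv (v1_fps g m) / v1_fps g m) k" if "k < 2 * g" for k
    proof -
      have "fact k * fps_nth (fps_deriv (v1_fps g m) / v1_fps g m) k = (\<Sum>h=1..g. l h * r h ^ Suc k)"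
        using assms(1)[of "Suc k"] that by (simp add: kappa_conv_fps_nth)
      thus ?thesis by (simp add: fps_sum_nth field_simps sum_divide_distrib[symmetric])
    qed
    show "n \<le> 2 * g" using assms(2) by simp
  qed
  thus ?thesis using assms(2) by (simp add: fps_nth_v1_fps)
qed

section \<open>The Hankel and Vandermonde systems\<close>

text \<open>\<open>mat_inverse\<close> returns an option; a nonzero determinant makes it
  \<open>Some\<close>, so \<open>the\<close> yields the true inverse.\<close>

lemma mult_mat_inverse_vec:
  fixes M :: "real mat"
  assumes M: "M \<in> carrier_mat n n" and "Determinant.det M \<noteq> 0" and v: "v \<in> carrier_vec n"
  shows "M *\<^sub>v (the (mat_inverse M) *\<^sub>v v) = v" "the (mat_inverse M) *\<^sub>v v \<in> carrier_vec n"
proof -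
  obtain B where B: "mat_inverse M = Some B"
    using mat_inverse(1)[OF M, of "()"] det_non_zero_imp_unit[OF assms(1,2), of "()"]
    by (cases "mat_inverse M") auto
  note B' = mat_inverse(2)[OF M B]
  show "the (mat_inverse M) *\<^sub>v v \<in> carrier_vec n"
    using B B' v by (auto intro: mult_mat_vec_carrier)
  show "M *\<^sub>v (the (mat_inverse M) *\<^sub>v v) = v"
    using B B' M v by (simp add: assoc_mult_mat_vec[symmetric, of _ n n _ n])
qed

lemma mult_mat_vec_nth:
  "i < nr \<Longrightarrow> v \<in> carrier_vec nc \<Longrightarrow>
    vec_index (Matrix.mat nr nc f *\<^sub>v v) i = (\<Sum>j<nc. f (i, j) * vec_index v j)"
  by (auto simp: scalar_prod_def lessThan_atLeast0 intro!: sum.cong)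

section \<open>The Hankel matrix and the linear recurrence of the cumulants\<close>

lemma hankel_carrier [simp]: "hankel g m s \<in> carrier_mat g g"
  by (simp add: hankel_def)

lemma poly_q_poly:
  "poly (q_poly g m) x = Determinant.det (x \<cdot>\<^sub>m hankel g m 1 - hankel g m 2)"
proof -
  interpret comm_ring_hom "\<lambda>p. poly p x" by unfold_locales auto
  show ?thesis unfolding q_poly_def hom_det[symmetric]
    by (rule arg_cong[where f = Determinant.det]) (auto simp: hankel_def)
qed

text \<open>The reversed polynomial of \<open>det (x A - B)\<close> is \<open>det (A - y B)\<close>; at \<open>y = 0\<close> this compares
  \<open>det A\<close> with the leading coefficient.\<close>

lemma det_hankel_nonzero:
  assumes "1 \<le> g" and "degree (q_poly g m) = g"
  shows "Determinant.det (hankel g m 1) \<noteq> 0"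
proof -
  let ?A = "hankel g m 1" and ?B = "hankel g m 2" and ?q = "q_poly g m"
  define R where "R = Determinant.det
     (map_mat (\<lambda>c. [:c:]) ?A - [:0, 1:] \<cdot>\<^sub>m map_mat (\<lambda>c. [:c:]) ?B)"
  have R: "poly R y = Determinant.det (?A - y \<cdot>\<^sub>m ?B)" for y
  proof -
    interpret comm_ring_hom "\<lambda>p. poly p y" by unfold_locales auto
    show ?thesis unfolding R_def hom_det[symmetric]
      by (rule arg_cong[where f = Determinant.det]) (auto simp: hankel_def)
  qed
  \<comment> \<open>Taking y out of all g rows yields y^g q(1/y), which is the reflected polynomial
    because q has degree g.\<close>
  have "poly R y = poly (reflect_poly ?q) y" if "y \<noteq> 0" for y
  proof -
    have "?A - y \<cdot>\<^sub>m ?B = y \<cdot>\<^sub>m (inverse y \<cdot>\<^sub>m ?A - ?B)"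
      using that by (intro eq_matI) (auto simp: hankel_def right_diff_distrib)
    thus ?thesis using that assms(2)
      by (simp add: R poly_reflect_poly_nz poly_q_poly hankel_def)
  qed
  \<comment> \<open>Polynomials that agree off 0 agree at 0, where the reflected one takes the
    leading coefficient of q.\<close>
  hence "UNIV - {0} \<subseteq> {y. poly (R - reflect_poly ?q) y = 0}" by auto
  moreover have "infinite (UNIV - {0 :: real})"
    by (simp add: infinite_UNIV_char_0)
  ultimately have "R - reflect_poly ?q = 0"
    using poly_roots_finite finite_subset by blast
  hence "Determinant.det (?A - 0 \<cdot>\<^sub>m ?B) = lead_coeff ?q"
    using R[of 0] by simp
  moreover have "?A - 0 \<cdot>\<^sub>m ?B = ?A"
    by (intro eq_matI) (auto simp: hankel_def)
  moreover have "?q \<noteq> 0" using assms by auto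
  ultimately show ?thesis by simp
qed

text \<open>The coefficients express the would-be next column of the Hankel matrix through its
  columns. A root of q obeys the same recurrence because it is the ratio of a geometric sequence
  built from shifted cumulants.\<close>

lemma kappa_recurrence:
  assumes "Determinant.det (hankel g m 1) \<noteq> 0"
  obtains c where
    "\<And>i. i < g \<Longrightarrow> kappa g m (i + g + 1) = (\<Sum>j<g. c j * kappa g m (i + j + 1))"
    "\<And>x. poly (q_poly g m) x = 0 \<Longrightarrow> x ^ g = (\<Sum>j<g. c j * x ^ j)"
proof -
  let ?A = "hankel g m 1" and ?\<kappa> = "kappa g m"
  define b where "b = Matrix.vec g (\<lambda>i. ?\<kappa> (i + g + 1))"
  define c where "c = the (mat_inverse ?A) *\<^sub>v b"
  have b: "b \<in> carrier_vec g" by (simp add: b_def)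
  note inv = mult_mat_inverse_vec[OF hankel_carrier assms b, folded c_def]
  have c: "?\<kappa> (i + g + 1) = (\<Sum>j<g. vec_index c j * ?\<kappa> (i + j + 1))" if "i < g" for i
    using arg_cong[OF inv(1), of "\<lambda>v. vec_index v i"] that inv(2)
    by (simp add: hankel_def mult_mat_vec_nth b_def mult.commute del: index_mult_mat_vec)
  moreover have "x ^ g = (\<Sum>j<g. vec_index c j * x ^ j)" if "poly (q_poly g m) x = 0" for x
  proof -
    let ?M = "x \<cdot>\<^sub>m ?A - hankel g m 2"
    have M: "?M \<in> carrier_mat g g" by (rule minus_carrier_mat) (rule hankel_carrier)
    have "Determinant.det (transpose_mat ?M) = 0"
      using that det_transpose[OF M] by (simp add: poly_q_poly)
    then obtain w where w: "w \<in> carrier_vec g" "w \<noteq> 0\<^sub>v g" "transpose_mat ?M *\<^sub>v w = 0\<^sub>v g"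
      using det_0_iff_vec_prod_zero[of "transpose_mat ?M" g] M by auto
    \<comment> \<open>\<open>w\<close> is orthogonal to every column of \<open>?M\<close>, so
      pairing it with successive shifts of the cumulants gives a geometric sequence of ratio
      \<open>x\<close>.\<close>
    define y where "y j = (\<Sum>i<g. ?\<kappa> (i + j + 1) * vec_index w i)" for j
    have step: "y (Suc j) = x * y j" if "j < g" for j
    proof -
      have "transpose_mat ?M = Matrix.mat g g (\<lambda>(j, i). x * ?\<kappa> (i + j + 1) - ?\<kappa> (i + j + 2))"
        by (intro eq_matI) (auto simp: hankel_def)
      hence "(\<Sum>i<g. (x * ?\<kappa> (i + j + 1) - ?\<kappa> (i + j + 2)) * vec_index w i) = 0"
        using arg_cong[OF w(3), of "\<lambda>v. vec_index v j"] that w(1)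
        by (simp add: mult_mat_vec_nth del: index_mult_mat_vec)
      thus ?thesis by (simp add: y_def algebra_simps sum_subtractf sum_distrib_left)
    qed
    have y: "y j = x ^ j * y 0" if "j \<le> g" for j
      using that by (induction j) (simp_all add: step)
    \<comment> \<open>Otherwise all \<open>y j\<close> with \<open>j < g\<close> vanish, and
      \<open>w\<close> is a kernel vector of the transposed Hankel matrix, which is regular.\<close>
    have "y 0 \<noteq> 0"
    proof
      assume "y 0 = 0"
      have "transpose_mat ?A = Matrix.mat g g (\<lambda>(j, i). ?\<kappa> (i + j + 1))"
        by (intro eq_matI) (auto simp: hankel_def)
      moreover have "(\<Sum>i<g. ?\<kappa> (i + j + 1) * vec_index w i) = 0" if "j < g" for j
        using y[of j] \<open>y 0 = 0\<close> that by (simp add: y_def)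
      ultimately have "transpose_mat ?A *\<^sub>v w = 0\<^sub>v g"
        using w(1)
        by (intro eq_vecI) (simp_all add: mult_mat_vec_nth del: index_mult_mat_vec)
      hence "Determinant.det (transpose_mat ?A) = 0"
        using det_0_iff_vec_prod_zero[of "transpose_mat ?A" g] w(1,2) by auto
      thus False using assms det_transpose[OF hankel_carrier[of g m 1]] by simp
    qed
    have "x ^ g * y 0 = (\<Sum>i<g. ?\<kappa> (i + g + 1) * vec_index w i)"
      using y[of g] by (simp add: y_def)
    \<comment> \<open>The recurrence of the cumulants is applied inside the pairing.\<close>
    also have "\<dots> = (\<Sum>i<g. \<Sum>j<g. vec_index c j * (?\<kappa> (i + j + 1) * vec_index w i))"
      by (intro sum.cong refl) (simp add: c[simplified] sum_distrib_right mult.assoc)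
    also have "\<dots> = (\<Sum>j<g. vec_index c j * y j)"
      by (subst sum.swap) (simp add: y_def sum_distrib_left)
    also have "\<dots> = (\<Sum>j<g. vec_index c j * x ^ j) * y 0"
      unfolding sum_distrib_right by (intro sum.cong refl) (metis lessThan_iff less_imp_le mult.assoc y)
    finally show ?thesis using \<open>y 0 \<noteq> 0\<close> by simp
  qed
  ultimately show thesis by (rule that)
qed

text \<open>A kernel vector would be the coefficient vector of a nonzero polynomial of degree below
  g with g distinct roots.\<close>

lemma det_vandermonde_nonzero:
  assumes "inj_on r {1..g}"
  shows "Determinant.det (vandermonde g r) \<noteq> 0"
proof
  assume "Determinant.det (vandermonde g r) = 0"
  then obtain v where v: "v \<in> carrier_vec g" "v \<noteq> 0\<^sub>v g" "vandermonde g r *\<^sub>v v = 0\<^sub>v g"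
    using det_0_iff_vec_prod_zero[of "vandermonde g r" g] by (auto simp: vandermonde_def)
  define p where "p = (\<Sum>j<g. monom (vec_index v j) j)"
  have coeff: "poly.coeff p j = vec_index v j" if "j < g" for j
    using that by (simp add: p_def coeff_sum)
  have "p \<noteq> 0"
  proof
    assume "p = 0"
    hence "v = 0\<^sub>v g" using coeff v(1) by (intro eq_vecI) auto
    thus False using v(2) by contradiction
  qed
  have "g > 0" using \<open>p \<noteq> 0\<close> by (cases g) (auto simp: p_def)
  have "degree p < g"
    using \<open>g > 0\<close> by (auto simp: p_def intro!: degree_sum_less le_less_trans[OF degree_monom_le])
  have "poly p (r (Suc i)) = 0" if "i < g" for i
    using arg_cong[OF v(3), of "\<lambda>v. vec_index v i"] that v(1)
    by (simp add: vandermonde_def mult_mat_vec_nth p_def poly_sum poly_monom mult.commute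
        del: index_mult_mat_vec)
  hence "poly p (r h) = 0" if "h \<in> {1..g}" for h
    using that by (cases h) auto
  hence "r ` {1..g} \<subseteq> {x. poly p x = 0}" by auto
  hence "card (r ` {1..g}) \<le> card {x. poly p x = 0}"
    using \<open>p \<noteq> 0\<close> poly_roots_finite by (intro card_mono) auto
  also have "\<dots> \<le> degree p" using \<open>p \<noteq> 0\<close> by (rule card_poly_roots_bound)
  finally show False using \<open>degree p < g\<close> assms by (simp add: card_image)
qed

text \<open>Lambda solves V^T D lambda = (kappa_1, ..., kappa_g), and row \<open>i\<close> of this
  system is the claim; both matrices are regular as the \<open>r h\<close> are distinct and
  nonzero.\<close>

lemma sum_lam_low:
  assumes "inj_on r {1..g}" "\<And>h. h \<in> {1..g} \<Longrightarrow> r h \<noteq> 0" "i < g"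
  shows "(\<Sum>h=1..g. lam g m r h * r h ^ Suc i) = kappa g m (Suc i)"
proof -
  let ?V = "transpose_mat (vandermonde g r)" and ?D = "diag_roots g r"
    and ?k = "Matrix.vec g (\<lambda>i. kappa g m (Suc i))" and ?l = "lambda_vec g m r"
  have V: "vandermonde g r \<in> carrier_mat g g" and D: "?D \<in> carrier_mat g g"
    by (simp_all add: vandermonde_def diag_roots_def)
  have "Determinant.det ?V \<noteq> 0"
    using det_transpose[OF V] det_vandermonde_nonzero[OF assms(1)] by simp
  note invV = mult_mat_inverse_vec[OF transpose_carrier_mat[THEN iffD2, OF V] this, of ?k, simplified]
  have "Determinant.det ?D = prod_list (diag_mat ?D)"
    by (rule det_upper_triangular[OF _ D]) (auto simp: diag_roots_def)
  also have "\<dots> \<noteq> 0"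
    using assms(2) by (auto simp: prod_list_zero_iff diag_mat_def diag_roots_def)
  finally have "Determinant.det ?D \<noteq> 0" .
  note invD = mult_mat_inverse_vec[OF D this invV(2), folded lambda_vec_def]
  have Dl: "vec_index (?D *\<^sub>v ?l) j = r (Suc j) * lam g m r (Suc j)" if "j < g" for j
    using that invD(2)
    by (simp add: diag_roots_def mult_mat_vec_nth lam_def if_distrib[of "\<lambda>x. x * _"]
        del: index_mult_mat_vec cong: if_cong)
  have "?V = Matrix.mat g g (\<lambda>(i, j). r (Suc j) ^ i)"
    by (intro eq_matI) (auto simp: vandermonde_def)
  moreover have "?V *\<^sub>v (?D *\<^sub>v ?l) = ?k"
    using invD(1) invV(1) by simp
  moreover have "?D *\<^sub>v ?l \<in> carrier_vec g"
    using D invD(2) by (rule mult_mat_vec_carrier)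
  ultimately have "kappa g m (Suc i) = (\<Sum>j<g. r (Suc j) ^ i * vec_index (?D *\<^sub>v ?l) j)"
    using mult_mat_vec_nth[of i g "?D *\<^sub>v ?l" g "\<lambda>(i, j). r (Suc j) ^ i"] assms(3) by simp
  also have "(\<Sum>j<g. r (Suc j) ^ i * vec_index (?D *\<^sub>v ?l) j) =
      (\<Sum>j<g. lam g m r (Suc j) * r (Suc j) ^ Suc i)"
    by (intro sum.cong refl) (simp add: Dl mult_ac del: index_mult_mat_vec)
  also have "\<dots> = (\<Sum>h=1..g. lam g m r h * r h ^ Suc i)"
    by (rule sum.reindex_bij_witness[where i = "\<lambda>h. h - 1" and j = Suc]) auto
  finally show ?thesis by (rule sym)
qed

lemma kappa_eq_sum_lam:
  assumes "1 \<le> g" "degree (q_poly g m) = g"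
    and roots: "\<And>h. h \<in> {1..g} \<Longrightarrow> poly (q_poly g m) (r h) = 0"
    and "inj_on r {1..g}" "\<And>h. h \<in> {1..g} \<Longrightarrow> r h \<noteq> 0"
    and "n \<in> {1..2*g}"
  shows "kappa g m n = (\<Sum>h=1..g. lam g m r h * r h ^ n)"
proof -
  obtain c where c: "\<And>i. i < g \<Longrightarrow> kappa g m (i + g + 1) = (\<Sum>j<g. c j * kappa g m (i + j + 1))"
    "\<And>x. poly (q_poly g m) x = 0 \<Longrightarrow> x ^ g = (\<Sum>j<g. c j * x ^ j)"
    using kappa_recurrence[OF det_hankel_nonzero[OF assms(1,2)]] by blast
  show ?thesis using \<open>n \<in> {1..2*g}\<close>
  proof (induction n rule: less_induct)
    case (less n)
    show ?case
    proof (cases "n \<le> g")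
      case True
      thus ?thesis using sum_lam_low[OF assms(4,5), of "n - 1"] less.prems by (cases n) auto
    next
      case False
      \<comment> \<open>With this offset \<open>i < g\<close> amounts to \<open>n <= 2 * g\<close>,
        and each \<open>i + j + 1\<close> with \<open>j < g\<close> is at least 1 and below
        \<open>n\<close>.\<close>
      define i where "i = n - g - 1"
      have i: "n = i + g + 1" "i < g" using False less.prems by (auto simp: i_def)
      have "kappa g m n = (\<Sum>j<g. c j * (\<Sum>h=1..g. lam g m r h * r h ^ (i + j + 1)))"
        unfolding i(1) c(1)[OF i(2)]
      proof (intro sum.cong refl arg_cong2[where f = "(*)"])
        fix j assume "j \<in> {..<g}"
        thus "kappa g m (i + j + 1) = (\<Sum>h=1..g. lam g m r h * r h ^ (i + j + 1))"
          using i by (intro less.IH) auto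
      qed
      also have "\<dots> = (\<Sum>h=1..g. lam g m r h * r h ^ (i + 1) * (\<Sum>j<g. c j * r h ^ j))"
        unfolding sum_distrib_left by (subst sum.swap) (simp add: power_add mult_ac)
      also have "\<dots> = (\<Sum>h=1..g. lam g m r h * r h ^ (i + 1) * r h ^ g)"
        by (intro sum.cong refl) (simp only: c(2)[OF roots])
      also have "\<dots> = (\<Sum>h=1..g. lam g m r h * r h ^ n)"
        by (simp add: i(1) power_add mult_ac)
      finally show ?thesis .
    qed
  qed
qed

section \<open>The Markov chain of group sizes\<close>

lemma (in prob_space) expectation_sum_indicator:
  fixes c :: "'i \<Rightarrow> real"
  assumes "finite I" "\<And>i. i \<in> I \<Longrightarrow> S i \<in> events"
  shows "expectation (\<lambda>\<omega>. \<Sum>i\<in>I. c i * indicator (S i) \<omega>) = (\<Sum>i\<in>I. c i * prob (S i))"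
proof (subst Bochner_Integration.integral_sum)
  show "integrable M (\<lambda>\<omega>. c i * indicator (S i) \<omega>)" if "i \<in> I" for i
    using assms(2)[OF that] by (intro integrable_mult_right integrable_real_indicator)
      (auto simp: emeasure_eq_measure)
qed (use assms(2) in \<open>auto intro!: sum.cong simp: sets.sets_into_space Int_absorb1\<close>)

context multi_group_model
begin

text \<open>The whole history as one value: padding with 0 makes histories that agree at the
  observed indices equal as functions.\<close>

definition hist :: "nat \<Rightarrow> 'a \<Rightarrow> (nat \<Rightarrow> nat \<Rightarrow> nat) \<times> (nat \<Rightarrow> real)" where
  "hist t \<omega> = (\<lambda>h s. if h \<in> {1..g} \<and> s \<le> t then G h s \<omega> else 0, \<lambda>s. if s \<le> t then p s \<omega> else 0)"

text \<open>Label 0 stands for the choice of an inactive investor.\<close>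

definition step_event :: "nat \<Rightarrow> nat \<Rightarrow> 'a \<Rightarrow> bool" where
  "step_event t l \<omega> = (if l = 0 then inactive_step g G p t \<omega> else active_step g f G p l t \<omega>)"

definition step_prob :: "nat \<Rightarrow> (nat \<Rightarrow> nat) \<Rightarrow> real" where
  "step_prob l a = (if l = 0 then real N - (\<Sum>h=1..g. real (a h)) else real (a l)) / real N"

definition step_sizes :: "nat \<Rightarrow> (nat \<Rightarrow> nat) \<Rightarrow> nat \<Rightarrow> nat" where
  "step_sizes l a = (if l = 0 then a else a(l := a l - 1))"

text \<open>Extensional, so that the values lie in a finite product of counting spaces, where every
  function is measurable.\<close>

definition sizes :: "nat \<Rightarrow> 'a \<Rightarrow> nat \<Rightarrow> nat" where
  "sizes t \<omega> = (\<lambda>h\<in>{1..g}. G h t \<omega>)"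

text \<open>Taking \<open>x\<close> from the range fixes its padding, since
  \<open>has_history\<close> constrains only the observed entries.\<close>

lemma hist_eq_iff:
  assumes "x \<in> range (hist t)"
  shows "hist t \<omega> = x \<longleftrightarrow> has_history g G p t (fst x) (snd x) \<omega>"
proof
  have "has_history g G p t (fst (hist t \<omega>)) (snd (hist t \<omega>)) \<omega>"
    by (simp add: hist_def has_history_def)
  thus "hist t \<omega> = x \<Longrightarrow> has_history g G p t (fst x) (snd x) \<omega>" by simp
  show "has_history g G p t (fst x) (snd x) \<omega> \<Longrightarrow> hist t \<omega> = x"
    using assms by (auto simp: hist_def has_history_def fun_eq_iff)
qed

lemma hist_eq_imp_sizes: "hist t \<omega> = x \<Longrightarrow> sizes t \<omega> = (\<lambda>h\<in>{1..g}. fst x h t)"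
  by (auto simp: hist_def sizes_def)

section \<open>Transition events and the finiteness of the set of histories\<close>

lemma G_eq_const_measurable: "h \<in> {1..g} \<Longrightarrow> Measurable.pred P (\<lambda>\<omega>. G h t \<omega> = n)"
  using G_measurable[of h t] by measurable

lemma G_eq_measurable:
  assumes "h \<in> {1..g}"
  shows "Measurable.pred P (\<lambda>\<omega>. G h t \<omega> = G h s \<omega> + n)"
proof -
  \<comment> \<open>The relation between two integer variables is split into countably many cases by
    the value of one of them.\<close>
  have "Measurable.pred P (\<lambda>\<omega>. \<exists>k. G h s \<omega> = k \<and> G h t \<omega> = k + n)"
    using assms by (intro pred_intros_countable pred_intros_logic G_eq_const_measurable)
  thus ?thesis by simp
qed

lemma has_history_measurable: "Measurable.pred P (has_history g G p t \<nu> \<pi>)"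
proof -
  have "Measurable.pred P (\<lambda>\<omega>. p s \<omega> = c)" for s c
    using p_measurable by measurable
  hence "Measurable.pred P (\<lambda>\<omega>. \<forall>s\<in>{..t}. (\<forall>h\<in>{1..g}. G h s \<omega> = \<nu> h s) \<and> p s \<omega> = \<pi> s)"
    by (intro pred_intros_finite pred_intros_logic G_eq_const_measurable) auto
  moreover have "has_history g G p t \<nu> \<pi> =
      (\<lambda>\<omega>. \<forall>s\<in>{..t}. (\<forall>h\<in>{1..g}. G h s \<omega> = \<nu> h s) \<and> p s \<omega> = \<pi> s)"
    by (simp add: has_history_def fun_eq_iff Ball_def)
  ultimately show ?thesis by (simp only:)
qed

lemma step_event_measurable:
  assumes "l \<le> g"
  shows "Measurable.pred P (step_event t l)"
proof -
  have 1: "Measurable.pred P (\<lambda>\<omega>. p (Suc t) \<omega> = c * p t \<omega>)" for c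
    using p_measurable by measurable
  show ?thesis
  proof (cases "l = 0")
    case True
    have "step_event t l =
        (\<lambda>\<omega>. p (Suc t) \<omega> = 1 * p t \<omega> \<and> (\<forall>i\<in>{1..g}. G i (Suc t) \<omega> = G i t \<omega> + 0))"
      using True by (simp add: step_event_def inactive_step_def fun_eq_iff)
    moreover have "Measurable.pred P \<dots>"
      by (intro pred_intros_finite pred_intros_logic 1 G_eq_measurable finite_atLeastAtMost)
    ultimately show ?thesis by (simp only:)
  next
    case False
    have "step_event t l = (\<lambda>\<omega>. p (Suc t) \<omega> = f l * p t \<omega> \<and> G l t \<omega> = G l (Suc t) \<omega> + 1 \<and>
        (\<forall>i\<in>{1..g} - {l}. G i (Suc t) \<omega> = G i t \<omega> + 0))"
      using False by (simp add: step_event_def active_step_def fun_eq_iff)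
    moreover have "Measurable.pred P \<dots>"
      using False assms
      by (intro pred_intros_finite pred_intros_logic 1 G_eq_measurable finite_Diff finite_atLeastAtMost)
        auto
    ultimately show ?thesis by (simp only:)
  qed
qed

text \<open>Labels are told apart by the group that shrinks: none for 0, only \<open>l\<close> for a
  positive label \<open>l\<close>.\<close>

lemma step_event_unique:
  assumes "step_event t l \<omega>" "step_event t l' \<omega>" "l \<le> g" "l' \<le> g"
  shows "l = l'"
proof -
  have dec: "G l t \<omega> \<noteq> G l (Suc t) \<omega> \<and> (\<forall>i\<in>{1..g}-{l}. G i (Suc t) \<omega> = G i t \<omega>)"
    if "step_event t l \<omega>" "l \<noteq> 0" for l
    using that by (auto simp: step_event_def active_step_def)
  have inact: "G i (Suc t) \<omega> = G i t \<omega>" if "step_event t 0 \<omega>" "i \<in> {1..g}" for i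
    using that by (auto simp: step_event_def inactive_step_def)
  show ?thesis
    using dec[of l] dec[of l'] inact[of l] inact[of l'] assms
    by (cases "l = 0"; cases "l' = 0") (force simp: not_less_eq_eq)+
qed

lemma sum_step_prob: "(\<Sum>l\<le>g. step_prob l a) = 1"
proof -
  have "(\<Sum>l\<le>g. step_prob l a) = step_prob 0 a + (\<Sum>l=1..g. step_prob l a)"
    by (simp add: atMost_atLeast0 sum.atLeast_Suc_atMost)
  also have "\<dots> = (real N - (\<Sum>h=1..g. real (a h))) / N + (\<Sum>l=1..g. real (a l) / N)"
    by (intro arg_cong2[where f = "(+)"] sum.cong) (auto simp: step_prob_def)
  finally show ?thesis
    using N_ge_1 by (simp add: sum_divide_distrib[symmetric] field_simps)
qed

lemma step_prob_cong: "(\<And>h. h \<in> {1..g} \<Longrightarrow> a h = b h) \<Longrightarrow> l \<le> g \<Longrightarrow> step_prob l a = step_prob l b"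
  by (auto simp: step_prob_def intro!: sum.cong)

text \<open>Multiplying out the conditional probability extends the transition law to histories of
  probability 0, where both sides vanish.\<close>

lemma prob_step_event:
  assumes "l \<le> g"
  shows "\<P>(\<omega> in P. step_event t l \<omega> \<and> has_history g G p t \<nu> \<pi> \<omega>) =
    step_prob l (\<lambda>h. \<nu> h t) * \<P>(\<omega> in P. has_history g G p t \<nu> \<pi> \<omega>)"
proof (cases "\<P>(\<omega> in P. has_history g G p t \<nu> \<pi> \<omega>) > 0")
  case True
  have "\<P>(\<omega> in P. step_event t l \<omega> \<bar> has_history g G p t \<nu> \<pi> \<omega>) = step_prob l (\<lambda>h. \<nu> h t)"
    using active[OF _ True, of l] inactive[OF True] assms
    by (cases "l = 0") (simp_all add: step_event_def step_prob_def cong: if_cong)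
  thus ?thesis using True by (simp add: cond_prob_def field_simps)
next
  case False
  hence 0: "\<P>(\<omega> in P. has_history g G p t \<nu> \<pi> \<omega>) = 0"
    by (meson measure_nonneg not_le order_antisym)
  have "\<P>(\<omega> in P. step_event t l \<omega> \<and> has_history g G p t \<nu> \<pi> \<omega>) \<le>
      \<P>(\<omega> in P. has_history g G p t \<nu> \<pi> \<omega>)"
    using has_history_measurable by (intro finite_measure_mono) auto
  thus ?thesis using 0 by (simp add: measure_le_0_iff)
qed

text \<open>The step events are disjoint and their conditional probabilities sum to 1, so they
  exhaust every history up to a null set; finiteness of \<open>A\<close> allows these null sets to
  be united.\<close>

lemma AE_step_event_if_finite_hist:
  assumes "finite A" "A \<subseteq> range (hist t)" "AE \<omega> in P. hist t \<omega> \<in> A"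
  shows "AE \<omega> in P. \<exists>l\<le>g. step_event t l \<omega>"
proof -
  have "AE \<omega> in P. has_history g G p t \<nu> \<pi> \<omega> \<longrightarrow> (\<exists>l\<le>g. step_event t l \<omega>)" for \<nu> \<pi>
  proof -
    let ?H = "has_history g G p t \<nu> \<pi>"
    let ?E = "{\<omega> \<in> space P. ?H \<omega>}" and ?S = "\<lambda>l. {\<omega> \<in> space P. step_event t l \<omega> \<and> ?H \<omega>}"
    have sets: "?E \<in> events" "l \<le> g \<Longrightarrow> ?S l \<in> events" for l
      using has_history_measurable[of t \<nu> \<pi>] step_event_measurable[of l t] by measurable
    have "prob (\<Union>l\<in>{..g}. ?S l) = (\<Sum>l\<le>g. prob (?S l))"
      using step_event_unique[of t]
      by (intro finite_measure_finite_Union) (auto simp: sets disjoint_family_on_def)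
    also have "\<dots> = (\<Sum>l\<le>g. step_prob l (\<lambda>h. \<nu> h t)) * prob ?E"
      unfolding sum_distrib_right by (intro sum.cong refl prob_step_event) auto
    also have "\<dots> = prob ?E" by (simp add: sum_step_prob)
    finally have "prob (?E - (\<Union>l\<in>{..g}. ?S l)) = 0"
      using sets by (subst finite_measure_Diff) auto
    hence "?E - (\<Union>l\<in>{..g}. ?S l) \<in> null_sets P"
      using sets by (subst null_sets_def) (auto simp: emeasure_eq_measure)
    from AE_not_in[OF this] AE_space show ?thesis by eventually_elim auto
  qed
  hence "AE \<omega> in P. \<forall>x\<in>A. has_history g G p t (fst x) (snd x) \<omega> \<longrightarrow> (\<exists>l\<le>g. step_event t l \<omega>)"
    using assms(1) by (intro AE_finite_allI)
  with assms(3) show ?thesis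
    by eventually_elim (use assms(2) hist_eq_iff in blast)
qed

text \<open>Finitely many histories at time \<open>t\<close> give a labelled step almost surely, and
  then each history has at most g + 1 continuations.\<close>

lemma ex_finite_hist:
  "\<exists>A. finite A \<and> A \<subseteq> range (hist t) \<and> (AE \<omega> in P. hist t \<omega> \<in> A)"
proof (induction t)
  case 0
  let ?x = "(\<lambda>h s. if h \<in> {1..g} \<and> s \<le> 0 then N0 h else 0, \<lambda>s. if s \<le> 0 then p0 else 0)"
  have "AE \<omega> in P. hist 0 \<omega> \<in> {?x} \<inter> range (hist 0)"
    using initial by eventually_elim (auto simp: hist_def fun_eq_iff)
  thus ?case by (intro exI[of _ "{?x} \<inter> range (hist 0)"]) auto
next
  case (Suc t)
  then obtain A where A: "finite A" "A \<subseteq> range (hist t)" "AE \<omega> in P. hist t \<omega> \<in> A" by blast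
  \<comment> \<open>The history at time \<open>t\<close> and the label of the step determine the
    history at time \<open>Suc t\<close>.\<close>
  define ext where "ext = (\<lambda>l (\<nu> :: nat \<Rightarrow> nat \<Rightarrow> nat, \<pi> :: nat \<Rightarrow> real).
    (\<lambda>h s. if h \<in> {1..g} \<and> s = Suc t then step_sizes l (\<lambda>h. \<nu> h t) h else \<nu> h s,
     \<lambda>s. if s = Suc t then (if l = 0 then 1 else f l) * \<pi> t else \<pi> s))"
  have ext: "hist (Suc t) \<omega> = ext l (hist t \<omega>)" if "step_event t l \<omega>" "l \<le> g" for l \<omega>
    using that
    by (cases "l = 0") (auto simp: ext_def hist_def fun_eq_iff step_event_def active_step_def
      inactive_step_def step_sizes_def le_Suc_eq)
  have "AE \<omega> in P. hist (Suc t) \<omega> \<in> (\<Union>l\<in>{..g}. ext l ` A) \<inter> range (hist (Suc t))"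
    using A(3) AE_step_event_if_finite_hist[OF A] by eventually_elim (use ext in blast)
  moreover have "finite ((\<Union>l\<in>{..g}. ext l ` A) \<inter> range (hist (Suc t)))"
    using A(1) by auto
  ultimately show ?case by blast
qed

lemma AE_step_event: "AE \<omega> in P. \<exists>l\<le>g. step_event t l \<omega>"
  using ex_finite_hist[of t] AE_step_event_if_finite_hist by blast

section \<open>Expectations of functions of the group sizes\<close>

lemma sizes_step:
  assumes "step_event t l \<omega>" "l \<le> g"
  shows "sizes (Suc t) \<omega> = step_sizes l (sizes t \<omega>)"
  using assms by (cases "l = 0") (auto simp: sizes_def step_sizes_def step_event_def
      active_step_def inactive_step_def fun_eq_iff)

lemma sizes_measurable: "(\<lambda>\<omega>. \<phi> (sizes t \<omega>)) \<in> borel_measurable P" for \<phi> :: "(nat \<Rightarrow> nat) \<Rightarrow> real"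
proof (rule measurable_compose[of "sizes t" P "Pi\<^sub>M {1..g} (\<lambda>_. count_space UNIV)"])
  show "sizes t \<in> measurable P (Pi\<^sub>M {1..g} (\<lambda>_. count_space UNIV))"
    unfolding sizes_def by (rule measurable_restrict) (rule G_measurable)
  show "\<phi> \<in> borel_measurable (Pi\<^sub>M {1..g} (\<lambda>_. count_space UNIV))"
    by (subst count_space_PiM_finite) auto
qed

lemma integrable_sizes: "integrable P (\<lambda>\<omega>. \<phi> (sizes t \<omega>))" for \<phi> :: "(nat \<Rightarrow> nat) \<Rightarrow> real"
proof -
  obtain A where A: "finite A" "AE \<omega> in P. hist t \<omega> \<in> A" using ex_finite_hist by blast
  let ?F = "(\<lambda>x. norm (\<phi> (\<lambda>h\<in>{1..g}. fst x h t))) ` A"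
  have "AE \<omega> in P. norm (\<phi> (sizes t \<omega>)) \<le> Max ?F"
    using A(2) by eventually_elim (use A(1) hist_eq_imp_sizes in \<open>auto intro!: Max_ge\<close>)
  thus ?thesis by (intro integrable_const_bound sizes_measurable)
qed

text \<open>The Markov property: \<open>step_prob\<close> depends on the history only through the
  current sizes. Finite sums over histories and labels take the place of conditional
  expectations.\<close>

lemma expectation_sizes_Suc:
  fixes \<phi> :: "(nat \<Rightarrow> nat) \<Rightarrow> real"
  shows "expectation (\<lambda>\<omega>. \<phi> (sizes (Suc t) \<omega>)) =
    expectation (\<lambda>\<omega>. \<Sum>l\<le>g. step_prob l (sizes t \<omega>) * \<phi> (step_sizes l (sizes t \<omega>)))"
proof -
  obtain A where A: "finite A" "A \<subseteq> range (hist t)" "AE \<omega> in P. hist t \<omega> \<in> A"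
    using ex_finite_hist by blast
  define st where "st x = (\<lambda>h\<in>{1..g}. fst x h t)" for x :: "(nat \<Rightarrow> nat \<Rightarrow> nat) \<times> (nat \<Rightarrow> real)"
  define H where "H x = {\<omega> \<in> space P. has_history g G p t (fst x) (snd x) \<omega>}" for x
  define S where "S l x = {\<omega> \<in> space P. step_event t l \<omega> \<and> has_history g G p t (fst x) (snd x) \<omega>}"
    for l x
  have H: "\<omega> \<in> H x \<longleftrightarrow> hist t \<omega> = x" if "\<omega> \<in> space P" "x \<in> A" for \<omega> x
    using hist_eq_iff[of x t \<omega>] that A(2) by (auto simp: H_def)
  have S: "\<omega> \<in> S l x \<longleftrightarrow> step_event t l \<omega> \<and> hist t \<omega> = x" if "\<omega> \<in> space P" "x \<in> A" for \<omega> l x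
    using hist_eq_iff[of x t \<omega>] that A(2) by (auto simp: S_def)
  have sets: "H x \<in> events" "l \<le> g \<Longrightarrow> S l x \<in> events" for l x
    using has_history_measurable[of t "fst x" "snd x"] step_event_measurable[of l t]
    unfolding H_def S_def by measurable
  have prob_S: "prob (S l x) = step_prob l (st x) * prob (H x)" if "l \<le> g" for l x
    using prob_step_event[OF that, of t "fst x" "snd x"] that
      step_prob_cong[of "st x" "\<lambda>h. fst x h t" l]
    by (simp add: S_def H_def st_def)
  \<comment> \<open>On the cell of history \<open>x\<close> and label \<open>l\<close> the next
    sizes are constant, and the cells cover the space up to a null set.\<close>
  have "AE \<omega> in P. \<phi> (sizes (Suc t) \<omega>) =
      (\<Sum>x\<in>A. \<Sum>l\<le>g. \<phi> (step_sizes l (st x)) * indicator (S l x) \<omega>)"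
    using A(3) AE_step_event[of t] AE_space
  proof eventually_elim
    case (elim \<omega>)
    then obtain l where l: "l \<le> g" "step_event t l \<omega>" by blast
    have "(\<Sum>x\<in>A. \<Sum>l\<le>g. \<phi> (step_sizes l (st x)) * indicator (S l x) \<omega>) =
        (\<Sum>x\<in>A. \<Sum>l'\<le>g. if x = hist t \<omega> \<and> l' = l then \<phi> (step_sizes l (st x)) else 0)"
    proof (intro sum.cong refl)
      fix x l' assume "x \<in> A" "l' \<in> {..g}"
      hence "\<omega> \<in> S l' x \<longleftrightarrow> x = hist t \<omega> \<and> l' = l"
        using S[OF elim(3), of x l'] step_event_unique[of t l' \<omega> l] l by auto
      thus "\<phi> (step_sizes l' (st x)) * indicator (S l' x) \<omega> =
          (if x = hist t \<omega> \<and> l' = l then \<phi> (step_sizes l (st x)) else 0)"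
        by (cases "\<omega> \<in> S l' x") auto
    qed
    also have "\<dots> = (\<Sum>x\<in>A. if x = hist t \<omega> then \<phi> (step_sizes l (st x)) else 0)"
    proof (intro sum.cong refl)
      fix x
      show "(\<Sum>l'\<le>g. if x = hist t \<omega> \<and> l' = l then \<phi> (step_sizes l (st x)) else 0) =
          (if x = hist t \<omega> then \<phi> (step_sizes l (st x)) else 0)"
        using l(1) by (cases "x = hist t \<omega>") simp_all
    qed
    also have "\<dots> = \<phi> (step_sizes l (st (hist t \<omega>)))"
      using elim A(1) by simp
    also have "st (hist t \<omega>) = sizes t \<omega>"
      using hist_eq_imp_sizes[OF refl] by (simp add: st_def)
    finally show ?case using sizes_step[OF l(2,1)] by simp
  qed
  hence "expectation (\<lambda>\<omega>. \<phi> (sizes (Suc t) \<omega>)) =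
      expectation (\<lambda>\<omega>. \<Sum>x\<in>A. \<Sum>l\<le>g. \<phi> (step_sizes l (st x)) * indicator (S l x) \<omega>)"
    using sets by (intro integral_cong_AE sizes_measurable borel_measurable_sum) auto
  also have "\<dots> = (\<Sum>x\<in>A. \<Sum>l\<le>g. \<phi> (step_sizes l (st x)) * prob (S l x))"
    unfolding sum.cartesian_product case_prod_unfold
    using sets A(1) by (intro expectation_sum_indicator) auto
  also have "\<dots> = (\<Sum>x\<in>A. (\<Sum>l\<le>g. step_prob l (st x) * \<phi> (step_sizes l (st x))) * prob (H x))"
    unfolding sum_distrib_right by (intro sum.cong refl) (simp add: prob_S mult_ac)
  \<comment> \<open>Read backwards, the cells \<open>H x\<close> recombine into one expectation over
    the current sizes.\<close>
  also have "\<dots> = expectation (\<lambda>\<omega>. \<Sum>x\<in>A.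
      (\<Sum>l\<le>g. step_prob l (st x) * \<phi> (step_sizes l (st x))) * indicator (H x) \<omega>)"
    using sets A(1) by (intro expectation_sum_indicator[symmetric])
  also have "\<dots> = expectation (\<lambda>\<omega>. \<Sum>l\<le>g. step_prob l (sizes t \<omega>) * \<phi> (step_sizes l (sizes t \<omega>)))"
  proof (intro integral_cong_AE borel_measurable_sum)
    show "AE \<omega> in P. (\<Sum>x\<in>A. (\<Sum>l\<le>g. step_prob l (st x) * \<phi> (step_sizes l (st x))) * indicator (H x) \<omega>) =
        (\<Sum>l\<le>g. step_prob l (sizes t \<omega>) * \<phi> (step_sizes l (sizes t \<omega>)))"
      using A(3) AE_space
    proof eventually_elim
      case (elim \<omega>)
      have "(\<Sum>x\<in>A. (\<Sum>l\<le>g. step_prob l (st x) * \<phi> (step_sizes l (st x))) * indicator (H x) \<omega>) =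
          (\<Sum>x\<in>A. if x = hist t \<omega> then \<Sum>l\<le>g. step_prob l (st x) * \<phi> (step_sizes l (st x)) else 0)"
        using H[OF elim(2)] by (intro sum.cong refl) (simp add: indicator_def eq_commute[of _ "hist t \<omega>"])
      also have "\<dots> = (\<Sum>l\<le>g. step_prob l (st (hist t \<omega>)) * \<phi> (step_sizes l (st (hist t \<omega>))))"
        using elim A(1) by simp
      also have "st (hist t \<omega>) = sizes t \<omega>"
        using hist_eq_imp_sizes[OF refl] by (simp add: st_def)
      finally show ?case .
    qed
    show "(\<lambda>\<omega>. step_prob l (sizes t \<omega>) * \<phi> (step_sizes l (sizes t \<omega>))) \<in> borel_measurable P" for l
      by (rule sizes_measurable)
  qed (use sets in auto)
  finally show ?thesis .
qed

text \<open>Each choice from group h multiplies the price by \<open>f h\<close> and raises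
  \<open>N0 h - G h t\<close> by 1; the bound on \<open>G\<close> is carried along to make this
  truncated subtraction exact.\<close>

lemma AE_price:
  "AE \<omega> in P. (\<forall>h\<in>{1..g}. G h t \<omega> \<le> N0 h) \<and> p t \<omega> = p0 * (\<Prod>h=1..g. f h ^ (N0 h - G h t \<omega>))"
proof (induction t)
  case 0
  show ?case using initial by eventually_elim simp
next
  case (Suc t)
  show ?case using Suc AE_step_event[of t]
  proof eventually_elim
    case (elim \<omega>)
    then obtain l where l: "l \<le> g" "step_event t l \<omega>" by blast
    show ?case
    proof (cases "l = 0")
      case True
      thus ?thesis using elim l by (simp add: step_event_def inactive_step_def)
    next
      case False
      hence lg: "l \<in> {1..g}" using l(1) by simp
      have s: "p (Suc t) \<omega> = f l * p t \<omega>" "G l t \<omega> = G l (Suc t) \<omega> + 1"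
        "\<And>i. i \<in> {1..g} - {l} \<Longrightarrow> G i (Suc t) \<omega> = G i t \<omega>"
        using l False by (auto simp: step_event_def active_step_def)
      have le: "G h (Suc t) \<omega> \<le> N0 h" if "h \<in> {1..g}" for h
        using elim(1) s(2) s(3)[of h] that lg by (cases "h = l") fastforce+
      have "N0 l - G l (Suc t) \<omega> = Suc (N0 l - G l t \<omega>)"
        using s(2) elim(1) lg by fastforce
      moreover have "(\<Prod>h\<in>{1..g}-{l}. f h ^ (N0 h - G h (Suc t) \<omega>)) =
          (\<Prod>h\<in>{1..g}-{l}. f h ^ (N0 h - G h t \<omega>))"
        using s(3) by (intro prod.cong) auto
      ultimately have "(\<Prod>h=1..g. f h ^ (N0 h - G h (Suc t) \<omega>)) =
          f l * (\<Prod>h=1..g. f h ^ (N0 h - G h t \<omega>))"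
        using lg by (simp add: prod.remove[of _ l])
      thus ?thesis using le elim(1) s(1) by simp
    qed
  qed
qed

end

section \<open>Factorial moments\<close>

text \<open>The probability that \<open>k\<close> given investors have all been chosen by time \<open>t\<close>, by
  inclusion-exclusion over those that have not.\<close>

definition hit_coeff :: "nat \<Rightarrow> nat \<Rightarrow> nat \<Rightarrow> real" where
  "hit_coeff N t k = (\<Sum>j\<le>k. (-1) ^ j * real (k choose j) * (1 - real j / real N) ^ t)"

lemma hit_coeff_0: "hit_coeff N 0 k = (if k = 0 then 1 else 0)"
proof -
  have "hit_coeff N 0 k = (\<Sum>j\<le>k. of_nat (k choose j) * (-1) ^ j * 1 ^ (k - j))"
    by (simp add: hit_coeff_def mult.commute)
  also have "\<dots> = (-1 + 1) ^ k" by (rule binomial_ring[symmetric])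
  finally show ?thesis by simp
qed

text \<open>Conditioning on one draw: with probability k/N it hits one of the \<open>k\<close>
  investors and leaves \<open>k - 1\<close>. Algebraically this is the binomial absorption identity,
  term by term.\<close>

lemma hit_coeff_Suc:
  "hit_coeff N (Suc t) k =
    (1 - real k / real N) * hit_coeff N t k + real k / real N * hit_coeff N t (k - 1)"
proof (cases k)
  case (Suc i)
  have "(1 - real j / N) * real (k choose j) =
      (1 - real k / N) * real (k choose j) + real k / N * real (i choose j)" if "j \<le> k" for j
  proof -
    have "real (k - j) * real (k choose j) = real k * real (i choose j)"
    proof (cases "j = k")
      case False
      hence "j \<le> i" using that Suc by simp
      hence "(k - j) * (k choose j) = k * (i choose j)"
        using binomial_absorb_comp[of k j] Suc by simp
      thus ?thesis by (metis of_nat_mult)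
    qed (simp add: Suc)
    hence "(real k - real j) * real (k choose j) = real k * real (i choose j)"
      using that by (simp add: of_nat_diff)
    thus ?thesis by (cases "N = 0") (simp_all add: field_simps)
  qed
  hence "hit_coeff N (Suc t) k = (\<Sum>j\<le>k. (-1) ^ j * (1 - real j / N) ^ t *
      ((1 - real k / N) * real (k choose j) + real k / N * real (i choose j)))"
    unfolding hit_coeff_def by (intro sum.cong refl) (simp add: mult_ac)
  also have "\<dots> = (1 - real k / N) * hit_coeff N t k +
      real k / N * (\<Sum>j\<le>k. (-1) ^ j * real (i choose j) * (1 - real j / N) ^ t)"
    by (simp add: hit_coeff_def sum_distrib_left sum.distrib[symmetric] algebra_simps)
  \<comment> \<open>The term for \<open>j = k\<close> is 0 because \<open>k\<close> exceeds
    \<open>i\<close>.\<close>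
  also have "(\<Sum>j\<le>k. (-1) ^ j * real (i choose j) * (1 - real j / N) ^ t) = hit_coeff N t i"
    by (simp add: Suc hit_coeff_def)
  finally show ?thesis by (simp add: Suc)
qed (simp add: hit_coeff_def)

text \<open>At the observation time (1 - j/N)^t tends to (1 - 1/C)^j, and the alternating binomial
  sum of these powers is (1 - (1 - 1/C))^k.\<close>

lemma hit_coeff_tendsto:
  assumes "C > 1"
  shows "(\<lambda>N. hit_coeff N (obs_time C N) k) \<longlonglongrightarrow> C powi (- int k)"
proof -
  define L where "L = - ln (1 - 1 / C)"
  have "L > 0" using assms by (simp add: L_def)
  have lim: "(\<lambda>N. (1 - real j / real N) ^ obs_time C N) \<longlonglongrightarrow> (1 - 1 / C) ^ j" for j
  proof -
    have "(\<lambda>N. of_int \<lfloor>real N * L\<rfloor> * ln (1 - real j / real N)) \<longlonglongrightarrow> - real j * L"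
    proof (cases "j = 0")
      case False
      have "(\<lambda>N. of_int \<lfloor>real N * L\<rfloor> * ln (1 - a / real N)) \<longlonglongrightarrow> - a * L" if "a > 0" for a :: real
        using \<open>L > 0\<close> that by real_asymp
      thus ?thesis using False by simp
    qed simp
    hence "(\<lambda>N. exp (of_int \<lfloor>real N * L\<rfloor> * ln (1 - real j / real N))) \<longlonglongrightarrow> exp (- real j * L)"
      by (rule tendsto_exp)
    \<comment> \<open>\<open>N > j\<close> keeps the base positive, so that its power is the
      exponential of a logarithm.\<close>
    moreover have "\<forall>\<^sub>F N in sequentially. exp (of_int \<lfloor>real N * L\<rfloor> * ln (1 - real j / real N)) =
        (1 - real j / real N) ^ obs_time C N"
      using eventually_gt_at_top[of j]
    proof eventually_elim
      case (elim N)
      have "real (obs_time C N) = of_int \<lfloor>real N * L\<rfloor>"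
        using \<open>L > 0\<close> by (simp add: obs_time_def L_def mult_nonneg_nonpos)
      moreover have "1 - real j / real N > 0" using elim by (simp add: field_simps)
      ultimately show ?case by (simp add: exp_of_nat_mult flip: \<open>real (obs_time C N) = _\<close>)
    qed
    moreover have "exp (- real j * L) = (1 - 1 / C) ^ j"
      using assms by (simp add: L_def exp_of_nat_mult)
    ultimately show ?thesis by (simp add: filterlim_cong)
  qed
  have "(\<lambda>N. hit_coeff N (obs_time C N) k) \<longlonglongrightarrow>
      (\<Sum>j\<le>k. (-1) ^ j * real (k choose j) * (1 - 1 / C) ^ j)"
    unfolding hit_coeff_def by (intro tendsto_intros lim)
  also have "(\<Sum>j\<le>k. (-1) ^ j * real (k choose j) * (1 - 1 / C) ^ j) =
      (\<Sum>j\<le>k. of_nat (k choose j) * (- (1 - 1 / C)) ^ j * 1 ^ (k - j))"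
  proof (intro sum.cong refl)
    have "(-1) ^ j * c * x ^ j = c * (- x) ^ j * 1 ^ i" for c x :: real and i j
      by (simp add: power_minus[of x])
    thus "(-1) ^ j * real (k choose j) * (1 - 1 / C) ^ j =
        real (k choose j) * (- (1 - 1 / C)) ^ j * 1 ^ (k - j)" for j .
  qed
  also have "\<dots> = (- (1 - 1 / C) + 1) ^ k" by (rule binomial_ring[symmetric])
  also have "\<dots> = C powi (- int k)" by (simp add: power_int_minus power_one_over inverse_eq_divide)
  finally show ?thesis .
qed

text \<open>The difference rule: one more chosen investor changes a falling factorial by a lower
  one. At \<open>k = 0\<close> the truncated \<open>k - 1\<close> is harmless because of the factor
  \<open>k\<close>.\<close>

lemma falling_fact_Suc_left:
  "falling_fact (Suc a) k = falling_fact a k + real k * falling_fact a (k - 1)"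
proof (induction k)
  case (Suc k)
  show ?case
  proof (cases k)
    case (Suc i)
    have "falling_fact (Suc a) (Suc k) =
        (falling_fact a k + real k * falling_fact a i) * (real (Suc a) - real k)"
      using Suc.IH Suc by (simp add: falling_fact_Suc)
    also have "\<dots> = falling_fact a k * (real a - real k + 1) +
        real k * (falling_fact a i * (real a - real i))"
      using Suc by (simp add: algebra_simps)
    also have "falling_fact a i * (real a - real i) = falling_fact a k"
      using Suc by (simp add: falling_fact_Suc)
    finally show ?thesis by (simp add: falling_fact_Suc algebra_simps)
  qed (simp add: falling_fact_def)
qed (simp add: falling_fact_def)

lemma falling_fact_pred: "k > 0 \<Longrightarrow>
    falling_fact a (k - 1) * (real a - real (k - 1)) = falling_fact a k"
  by (cases k) (simp_all add: falling_fact_Suc)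

section \<open>Factorial moments of the numbers of chosen investors\<close>

context multi_group_model
begin

text \<open>With \<open>a\<close> the current sizes, \<open>N0 h - a h\<close> members of group h
  have been chosen, and the value counts the families of ordered \<open>k h\<close>-tuples of
  distinct chosen members.\<close>

definition hit_fact :: "(nat \<Rightarrow> nat) \<Rightarrow> (nat \<Rightarrow> nat) \<Rightarrow> real" where
  "hit_fact k a = (\<Prod>h=1..g. falling_fact (N0 h - a h) (k h))"

lemma hit_fact_decr:
  assumes h: "h \<in> {1..g}" and "0 < a h" "a h \<le> N0 h"
  shows "hit_fact k (a(h := a h - 1)) = hit_fact k a + real (k h) * hit_fact (k(h := k h - 1)) a"
proof -
  let ?R = "\<Prod>i\<in>{1..g}-{h}. falling_fact (N0 i - a i) (k i)"
  have split: "hit_fact k' a' = falling_fact (N0 h - a' h) (k' h) * ?R"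
    if "\<And>i. i \<noteq> h \<Longrightarrow> k' i = k i" "\<And>i. i \<noteq> h \<Longrightarrow> a' i = a i" for k' a'
    using h that unfolding hit_fact_def by (simp add: prod.remove[of _ h])
  have "N0 h - (a h - 1) = Suc (N0 h - a h)" using assms by simp
  thus ?thesis
    by (simp add: split falling_fact_Suc_left[of "N0 h - a h"] algebra_simps)
qed

text \<open>With K chosen members, a_h is N0_h - (k_h - 1) minus K - (k_h - 1). The second part
  raises order k_h - 1 to k_h, so the recursion closes.\<close>

lemma hit_fact_step_aux:
  assumes h: "h \<in> {1..g}" and "a h \<le> N0 h"
  shows "real (a h) * hit_fact k (a(h := a h - 1)) = real (a h) * hit_fact k a +
    real (k h) * (real (N0 h) - real (k h - 1)) * hit_fact (k(h := k h - 1)) a -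
    real (k h) * hit_fact k a"
proof -
  let ?k' = "k(h := k h - 1)" and ?K = "N0 h - a h"
  let ?R = "\<Prod>i\<in>{1..g}-{h}. falling_fact (N0 i - a i) (k i)"
  have k: "hit_fact k a = falling_fact ?K (k h) * ?R"
    and k': "hit_fact ?k' a = falling_fact ?K (k h - 1) * ?R"
    using h unfolding hit_fact_def by (simp_all add: prod.remove[of _ h])
  have a: "real (a h) = real (N0 h) - real ?K" using assms(2) by (simp add: of_nat_diff)
  have pred: "real (k h) * (hit_fact ?k' a * (real ?K - real (k h - 1))) = real (k h) * hit_fact k a"
    unfolding k k' using falling_fact_pred[of "k h" ?K]
    by (cases "k h = 0") (simp_all add: mult.left_commute mult.commute[of "falling_fact _ _"])
  \<comment> \<open>For \<open>a h = 0\<close> both sides are 0, so only positive sizes are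
    decremented.\<close>
  have "real (a h) * hit_fact k (a(h := a h - 1)) =
      real (a h) * (hit_fact k a + real (k h) * hit_fact ?k' a)"
    using hit_fact_decr[of h a k] assms by (cases "a h = 0") auto
  also have "\<dots> = real (a h) * hit_fact k a +
      real (k h) * (real (N0 h) - real (k h - 1)) * hit_fact ?k' a -
      real (k h) * (hit_fact ?k' a * (real ?K - real (k h - 1)))"
    unfolding a by (simp only: algebra_simps)
  finally show ?thesis unfolding pred .
qed

text \<open>The size-dependent terms cancel between active and inactive choices, leaving the order
  \<open>k\<close> and orders with one coordinate lowered.\<close>

lemma hit_fact_step:
  assumes "\<And>h. h \<in> {1..g} \<Longrightarrow> a h \<le> N0 h"
  shows "(\<Sum>l\<le>g. step_prob l a * hit_fact k (step_sizes l a)) =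
    (1 - real (\<Sum>h=1..g. k h) / N) * hit_fact k a +
    (\<Sum>h=1..g. real (k h) * (real (N0 h) - real (k h - 1)) / N * hit_fact (k(h := k h - 1)) a)"
proof -
  let ?F = "hit_fact k a" and ?D = "\<lambda>h. real (k h) * (real (N0 h) - real (k h - 1)) * hit_fact (k(h := k h - 1)) a"
  have N: "real N \<noteq> 0" using N_ge_1 by simp
  have "(\<Sum>l\<le>g. step_prob l a * hit_fact k (step_sizes l a)) =
      step_prob 0 a * hit_fact k (step_sizes 0 a) + (\<Sum>l=1..g. step_prob l a * hit_fact k (step_sizes l a))"
    by (simp add: atMost_atLeast0 sum.atLeast_Suc_atMost)
  also have "(\<Sum>l=1..g. step_prob l a * hit_fact k (step_sizes l a)) =
      (\<Sum>l=1..g. (real (a l) * ?F + ?D l - real (k l) * ?F) / N)"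
  proof (intro sum.cong refl)
    fix l assume l: "l \<in> {1..g}"
    thus "step_prob l a * hit_fact k (step_sizes l a) = (real (a l) * ?F + ?D l - real (k l) * ?F) / N"
      unfolding hit_fact_step_aux[of l a k, OF l assms[OF l], symmetric]
      by (simp add: step_prob_def step_sizes_def)
  qed
  also have "\<dots> = ((\<Sum>l=1..g. real (a l)) * ?F + (\<Sum>l=1..g. ?D l) - (\<Sum>l=1..g. real (k l)) * ?F) / N"
    by (simp only: sum_divide_distrib[symmetric] sum.distrib sum_subtractf sum_distrib_right)
  also have "step_prob 0 a * hit_fact k (step_sizes 0 a) = (real N - (\<Sum>h=1..g. real (a h))) * ?F / N"
    by (simp add: step_prob_def step_sizes_def)
  also have "(real N - (\<Sum>h=1..g. real (a h))) * ?F / N +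
      ((\<Sum>l=1..g. real (a l)) * ?F + (\<Sum>l=1..g. ?D l) - (\<Sum>l=1..g. real (k l)) * ?F) / N =
      (1 - (\<Sum>h=1..g. real (k h)) / N) * ?F + (\<Sum>l=1..g. ?D l) / N"
    using N by (simp add: field_simps)
  finally show ?thesis by (simp add: sum_divide_distrib)
qed

lemma AE_sizes_le: "AE \<omega> in P. \<forall>h\<in>{1..g}. sizes t \<omega> h \<le> N0 h"
  using AE_price[of t] by eventually_elim (auto simp: sizes_def)

text \<open>The product counts all families of tuples; \<open>hit_coeff\<close> is the probability
  that the members of a given one have all been chosen. The induction generalises \<open>k\<close>,
  since a step lowers a coordinate.\<close>

lemma expectation_hit_fact:
  "expectation (\<lambda>\<omega>. hit_fact k (sizes t \<omega>)) =
    (\<Prod>h=1..g. falling_fact (N0 h) (k h)) * hit_coeff N t (\<Sum>h=1..g. k h)"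
proof (induction t arbitrary: k)
  case 0
  have "AE \<omega> in P. hit_fact k (sizes 0 \<omega>) = (\<Prod>h=1..g. falling_fact 0 (k h))"
    using initial by eventually_elim (simp add: hit_fact_def sizes_def)
  hence "expectation (\<lambda>\<omega>. hit_fact k (sizes 0 \<omega>)) = expectation (\<lambda>\<omega>. \<Prod>h=1..g. falling_fact 0 (k h))"
    by (intro integral_cong_AE sizes_measurable) auto
  also have "\<dots> = (\<Prod>h=1..g. falling_fact 0 (k h))" by (simp add: prob_space)
  also have "falling_fact 0 i = (if i = 0 then 1 else 0)" for i
    by (cases i) (auto simp: falling_fact_def intro!: prod_zero)
  hence "(\<Prod>h=1..g. falling_fact 0 (k h)) = (if \<forall>h\<in>{1..g}. k h = 0 then 1 else 0)"
    by (auto intro!: prod.neutral prod_zero)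
  also have "\<dots> = (\<Prod>h=1..g. falling_fact (N0 h) (k h)) * hit_coeff N 0 (\<Sum>h=1..g. k h)"
    by (auto simp: hit_coeff_0 falling_fact_def intro!: prod.neutral[symmetric])
  finally show ?case .
next
  case (Suc t)
  let ?K = "\<Sum>h=1..g. k h" and ?W = "\<lambda>k. \<Prod>h=1..g. falling_fact (N0 h) (k h)"
  let ?c = "\<lambda>h. real (k h) * (real (N0 h) - real (k h - 1)) / N" and ?k' = "\<lambda>h. k(h := k h - 1)"
  have "expectation (\<lambda>\<omega>. hit_fact k (sizes (Suc t) \<omega>)) =
      expectation (\<lambda>\<omega>. \<Sum>l\<le>g. step_prob l (sizes t \<omega>) * hit_fact k (step_sizes l (sizes t \<omega>)))"
    by (rule expectation_sizes_Suc)
  also have "\<dots> = expectation (\<lambda>\<omega>. (1 - real ?K / N) * hit_fact k (sizes t \<omega>) +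
      (\<Sum>h=1..g. ?c h * hit_fact (?k' h) (sizes t \<omega>)))"
  proof (rule integral_cong_AE)
    show "AE \<omega> in P. (\<Sum>l\<le>g. step_prob l (sizes t \<omega>) * hit_fact k (step_sizes l (sizes t \<omega>))) =
        (1 - real ?K / N) * hit_fact k (sizes t \<omega>) + (\<Sum>h=1..g. ?c h * hit_fact (?k' h) (sizes t \<omega>))"
      using AE_sizes_le[of t] by eventually_elim (intro hit_fact_step, auto)
  qed (rule sizes_measurable)+
  also have "\<dots> = (1 - real ?K / N) * expectation (\<lambda>\<omega>. hit_fact k (sizes t \<omega>)) +
      (\<Sum>h=1..g. ?c h * expectation (\<lambda>\<omega>. hit_fact (?k' h) (sizes t \<omega>)))"
    by (simp only: Bochner_Integration.integral_add Bochner_Integration.integral_sum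
        integral_mult_right_zero integrable_sizes integrable_mult_right Bochner_Integration.integrable_sum)
  also have "(\<Sum>h=1..g. ?c h * expectation (\<lambda>\<omega>. hit_fact (?k' h) (sizes t \<omega>))) =
      (\<Sum>h=1..g. real (k h) / N * (?W k * hit_coeff N t (?K - 1)))"
  proof (intro sum.cong refl)
    fix h assume h: "h \<in> {1..g}"
    show "?c h * expectation (\<lambda>\<omega>. hit_fact (?k' h) (sizes t \<omega>)) =
        real (k h) / N * (?W k * hit_coeff N t (?K - 1))"
    proof (cases "k h = 0")
      case False
      have "(\<Sum>i=1..g. ?k' h i) = (k h - 1) + (\<Sum>i\<in>{1..g}-{h}. k i)"
        using h by (simp add: sum.remove[of _ h])
      also have "\<dots> = ?K - 1" using h False by (simp add: sum.remove[of _ h])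
      finally have K: "(\<Sum>i=1..g. ?k' h i) = ?K - 1" .
      \<comment> \<open>This factor restores the one lost by lowering \<open>k h\<close>.\<close>
      have "(real (N0 h) - real (k h - 1)) * ?W (?k' h) = (falling_fact (N0 h) (k h - 1) *
          (real (N0 h) - real (k h - 1))) * (\<Prod>i\<in>{1..g}-{h}. falling_fact (N0 i) (k i))"
        using h by (simp add: prod.remove[of _ h])
      also have "\<dots> = ?W k"
        using h False by (subst falling_fact_pred) (simp_all add: prod.remove[of _ h])
      finally have W: "(real (N0 h) - real (k h - 1)) * ?W (?k' h) = ?W k" .
      show ?thesis unfolding Suc.IH K W[symmetric] by simp
    qed simp
  qed
  \<comment> \<open>The weights \<open>k h\<close> sum to the total order, which matches the
    recursion of \<open>hit_coeff\<close>.\<close>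
  also have "\<dots> = real ?K / N * (?W k * hit_coeff N t (?K - 1))"
    by (simp add: sum_distrib_right sum_divide_distrib)
  finally show ?case unfolding Suc.IH hit_coeff_Suc by (simp add: algebra_simps)
qed

text \<open>The log-return is linear in the numbers of chosen members. The multinomial theorem and
  Stirling numbers expand its powers into \<open>hit_fact\<close>, whose expectations are
  known.\<close>

lemma expectation_log_return_power:
  "expectation (\<lambda>\<omega>. ln (p t \<omega> / p 0 \<omega>) ^ n) =
    moment_form g N0 (\<lambda>h. ln (f h)) n (hit_coeff N t)"
proof -
  let ?r = "\<lambda>h. ln (f h)"
  let ?W = "{ns. ns \<in> {1..g} \<rightarrow>\<^sub>E UNIV \<and> (\<Sum>h=1..g. ns h) = n}"
  let ?c = "\<lambda>ns. fact n / (\<Prod>h=1..g. fact (ns h)) * (\<Prod>h=1..g. ?r h ^ ns h)"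
  let ?B = "\<lambda>ns :: nat \<Rightarrow> nat. \<Pi>\<^sub>E h\<in>{1..g}. {0..ns h}"
  let ?S = "\<lambda>ns ks. \<Prod>h=1..g. real (Stirling (ns h) (ks h))"
  have expand: "(\<Sum>h=1..g. real (N0 h - a h) * ?r h) ^ n =
      (\<Sum>ns\<in>?W. ?c ns * (\<Sum>ks\<in>?B ns. ?S ns ks * hit_fact ks a))" for a
  proof -
    have "(\<Sum>h=1..g. real (N0 h - a h) * ?r h) ^ n =
        (\<Sum>ns\<in>?W. ?c ns * (\<Prod>h=1..g. real (N0 h - a h) ^ ns h))"
      by (subst power_sum_multinomial) (simp_all add: power_mult_distrib prod.distrib mult_ac)
    also have "(\<lambda>ns. \<Prod>h=1..g. real (N0 h - a h) ^ ns h) =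
        (\<lambda>ns. \<Sum>ks\<in>?B ns. ?S ns ks * hit_fact ks a)"
      by (simp add: of_nat_power_eq_sum_Stirling prod_sum_PiE hit_fact_def prod.distrib)
    finally show ?thesis .
  qed
  have "AE \<omega> in P. ln (p t \<omega> / p 0 \<omega>) ^ n = (\<Sum>h=1..g. real (N0 h - sizes t \<omega> h) * ?r h) ^ n"
    using AE_price[of t] initial
  proof eventually_elim
    case (elim \<omega>)
    have "p t \<omega> / p 0 \<omega> = (\<Prod>h=1..g. f h ^ (N0 h - G h t \<omega>))"
      using elim p0_pos by simp
    also have "ln \<dots> = (\<Sum>h=1..g. ln (f h ^ (N0 h - G h t \<omega>)))"
      using f_pos by (intro ln_prod) (auto simp: less_imp_neq[symmetric])
    also have "\<dots> = (\<Sum>h=1..g. real (N0 h - sizes t \<omega> h) * ?r h)"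
      using f_pos by (intro sum.cong) (auto simp: ln_realpow sizes_def)
    finally show ?case by simp
  qed
  hence "expectation (\<lambda>\<omega>. ln (p t \<omega> / p 0 \<omega>) ^ n) =
      expectation (\<lambda>\<omega>. (\<Sum>h=1..g. real (N0 h - sizes t \<omega> h) * ?r h) ^ n)"
    using p_measurable by (intro integral_cong_AE sizes_measurable) auto
  also have "\<dots> = (\<Sum>ns\<in>?W. ?c ns * (\<Sum>ks\<in>?B ns. ?S ns ks *
      expectation (\<lambda>\<omega>. hit_fact ks (sizes t \<omega>))))"
    unfolding expand
    by (simp only: Bochner_Integration.integral_sum integral_mult_right_zero integrable_sizes
        integrable_mult_right Bochner_Integration.integrable_sum)
  also have "\<dots> = moment_form g N0 ?r n (hit_coeff N t)"
    unfolding expectation_hit_fact moment_form_def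
    by (simp add: prod.distrib mult_ac)
  finally show ?thesis .
qed

end

section \<open>Passage to the limits in N and C\<close>

lemma moment_form_tendsto:
  assumes "\<And>k. (\<lambda>N :: nat. c N k) \<longlonglongrightarrow> c' k"
  shows "(\<lambda>N. moment_form g a r n (c N)) \<longlonglongrightarrow> moment_form g a r n c'"
  unfolding moment_form_def by (intro tendsto_intros assms)

lemma poly_map_poly_of_real:
  "poly (map_poly of_real p) (of_real x) = (of_real (poly p x) :: 'a :: real_field)"
  by (induction p) (auto simp: map_poly_pCons)

theorem mainTheorem5:
  fixes g :: nat and m r :: "nat \<Rightarrow> real"
  assumes "1 \<le> g"
    and "degree (q_poly g m) = g"
    and "{z :: complex. poly (map_poly complex_of_real (q_poly g m)) z = 0} =
      complex_of_real ` r ` {1..g}"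
    and "strict_mono_on {1..g} r"
    and "\<And>h. h \<in> {1..g} \<Longrightarrow> r h \<noteq> 0"
    and "\<And>h. h \<in> {1..g} \<Longrightarrow> lam g m r h > 0"
  shows "\<forall>\<epsilon>>0.
    (\<exists>C0>1. \<forall>C\<ge>C0. \<forall>n\<in>{1..2*g}. \<bar>mu g m r C n - m n\<bar> < \<epsilon>) \<and>
    (\<forall>C>1. (\<forall>n\<in>{1..2*g}. \<bar>mu g m r C n - m n\<bar> < \<epsilon>) \<longrightarrow>
      (\<exists>N0\<ge>max 1 (\<Sum>h=1..g. init_size g m r C h). \<forall>N\<ge>N0. \<forall>(P :: 'a measure) p0 G p.
        multi_group_model P N g (init_size g m r C) (\<lambda>h. exp (r h)) p0 G p \<longrightarrow>
        (\<forall>n\<in>{1..2*g}.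
          \<bar>(\<integral>\<omega>. ln (p (obs_time C N) \<omega> / p 0 \<omega>) ^ n \<partial>P) - m n\<bar> < \<epsilon>))) \<and>
    (\<exists>C0>1. \<forall>C\<ge>C0.
      \<exists>N0\<ge>max 1 (\<Sum>h=1..g. init_size g m r C h). \<forall>N\<ge>N0. \<forall>(P :: 'a measure) p0 G p.
        multi_group_model P N g (init_size g m r C) (\<lambda>h. exp (r h)) p0 G p \<longrightarrow>
        (\<forall>n\<in>{1..2*g}.
          \<bar>(\<integral>\<omega>. ln (p (obs_time C N) \<omega> / p 0 \<omega>) ^ n \<partial>P) - m n\<bar> < \<epsilon>))"
proof (intro allI impI)
  fix \<epsilon> :: real assume "\<epsilon> > 0"
  have roots: "poly (q_poly g m) (r h) = 0" if "h \<in> {1..g}" for h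
  proof -
    have "complex_of_real (r h) \<in> {z. poly (map_poly complex_of_real (q_poly g m)) z = 0}"
      unfolding assms(3) using that by blast
    thus ?thesis by (simp add: poly_map_poly_of_real)
  qed
  have "inj_on r {1..g}" using assms(4) by (rule strict_mono_on_imp_inj_on)
  note kappa = kappa_eq_sum_lam[OF assms(1,2) roots this assms(5)]
  have mu_lim: "((\<lambda>C. mu g m r C n) \<longlongrightarrow> m n) at_top" if "n \<in> {1..2*g}" for n
  proof -
    have "((\<lambda>C. mu g m r C n) \<longlongrightarrow> fact n * fps_nth (\<Prod>h=1..g. poisson_fps (lam g m r h) (r h)) n) at_top"
      unfolding mu_eq_moment_form
      by (rule moment_form_tendsto_poisson)
        (simp add: init_size_def falling_fact_floor_tendsto assms(6))
    thus ?thesis using poisson_moment_eq[OF kappa that] by simp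
  qed
  have "\<forall>\<^sub>F C in at_top. \<forall>n\<in>{1..2*g}. \<bar>mu g m r C n - m n\<bar> < \<epsilon>"
    using tendstoD[OF mu_lim \<open>\<epsilon> > 0\<close>]
    by (intro eventually_ball_finite ballI) (simp_all add: dist_real_def)
  then obtain B where B: "\<And>C n. C \<ge> B \<Longrightarrow> n \<in> {1..2*g} \<Longrightarrow> \<bar>mu g m r C n - m n\<bar> < \<epsilon>"
    unfolding eventually_at_top_linorder by blast
  \<comment> \<open>The 2 ensures that the threshold exceeds 1.\<close>
  have i: "max B 2 > 1 \<and> (\<forall>C\<ge>max B 2. \<forall>n\<in>{1..2*g}. \<bar>mu g m r C n - m n\<bar> < \<epsilon>)"
    using B by auto
  have ii: "\<exists>N0\<ge>max 1 (\<Sum>h=1..g. init_size g m r C h). \<forall>N\<ge>N0. \<forall>(P :: 'a measure) p0 G p.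
      multi_group_model P N g (init_size g m r C) (\<lambda>h. exp (r h)) p0 G p \<longrightarrow>
      (\<forall>n\<in>{1..2*g}. \<bar>(\<integral>\<omega>. ln (p (obs_time C N) \<omega> / p 0 \<omega>) ^ n \<partial>P) - m n\<bar> < \<epsilon>)"
    if C: "C > 1" "\<forall>n\<in>{1..2*g}. \<bar>mu g m r C n - m n\<bar> < \<epsilon>" for C
  proof -
    \<comment> \<open>The exact moment, common to all models with these parameters, so the threshold
      for N can be fixed before the probability space.\<close>
    define M where "M N n = moment_form g (init_size g m r C) r n (hit_coeff N (obs_time C N))" for N n
    \<comment> \<open>The limit in N is \<open>mu\<close>, not \<open>m\<close>; the strict
      inequality assumed for \<open>mu\<close> persists for large N.\<close>
    have ev: "\<forall>\<^sub>F N in sequentially. \<bar>M N n - m n\<bar> < \<epsilon>" if n: "n \<in> {1..2*g}" for n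
    proof (rule order_tendstoD(2))
      show "(\<lambda>N. \<bar>M N n - m n\<bar>) \<longlonglongrightarrow> \<bar>mu g m r C n - m n\<bar>"
        unfolding M_def mu_eq_moment_form
        by (intro tendsto_intros moment_form_tendsto hit_coeff_tendsto \<open>C > 1\<close>)
    qed (use C(2) n in blast)
    have "\<forall>\<^sub>F N in sequentially. \<forall>n\<in>{1..2*g}. \<bar>M N n - m n\<bar> < \<epsilon>"
      by (intro eventually_ball_finite ballI ev) simp
    then obtain N1 where N1: "\<And>N n. N \<ge> N1 \<Longrightarrow> n \<in> {1..2*g} \<Longrightarrow> \<bar>M N n - m n\<bar> < \<epsilon>"
      unfolding eventually_sequentially by blast
    show ?thesis
    proof (intro exI[of _ "max N1 (max 1 (\<Sum>h=1..g. init_size g m r C h))"] conjI allI impI ballI)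
      fix N p0 G p n and P :: "'a measure"
      assume N: "N \<ge> max N1 (max 1 (\<Sum>h=1..g. init_size g m r C h))" and n: "n \<in> {1..2*g}"
        and "multi_group_model P N g (init_size g m r C) (\<lambda>h. exp (r h)) p0 G p"
      then interpret multi_group_model P N g "init_size g m r C" "\<lambda>h. exp (r h)" p0 G p by simp
      have "(\<integral>\<omega>. ln (p (obs_time C N) \<omega> / p 0 \<omega>) ^ n \<partial>P) = M N n"
        unfolding expectation_log_return_power M_def by simp
      thus "\<bar>(\<integral>\<omega>. ln (p (obs_time C N) \<omega> / p 0 \<omega>) ^ n \<partial>P) - m n\<bar> < \<epsilon>"
        using N1[of N n] N n by simp
    qed simp
  qed
  show "(\<exists>C0>1. \<forall>C\<ge>C0. \<forall>n\<in>{1..2*g}. \<bar>mu g m r C n - m n\<bar> < \<epsilon>) \<and>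
    (\<forall>C>1. (\<forall>n\<in>{1..2*g}. \<bar>mu g m r C n - m n\<bar> < \<epsilon>) \<longrightarrow>
      (\<exists>N0\<ge>max 1 (\<Sum>h=1..g. init_size g m r C h). \<forall>N\<ge>N0. \<forall>(P :: 'a measure) p0 G p.
        multi_group_model P N g (init_size g m r C) (\<lambda>h. exp (r h)) p0 G p \<longrightarrow>
        (\<forall>n\<in>{1..2*g}.
          \<bar>(\<integral>\<omega>. ln (p (obs_time C N) \<omega> / p 0 \<omega>) ^ n \<partial>P) - m n\<bar> < \<epsilon>))) \<and>
    (\<exists>C0>1. \<forall>C\<ge>C0.
      \<exists>N0\<ge>max 1 (\<Sum>h=1..g. init_size g m r C h). \<forall>N\<ge>N0. \<forall>(P :: 'a measure) p0 G p.
        multi_group_model P N g (init_size g m r C) (\<lambda>h. exp (r h)) p0 G p \<longrightarrow>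
        (\<forall>n\<in>{1..2*g}.
          \<bar>(\<integral>\<omega>. ln (p (obs_time C N) \<omega> / p 0 \<omega>) ^ n \<partial>P) - m n\<bar> < \<epsilon>))"
    (is "_ \<and> (\<forall>C>1. _ C \<longrightarrow> ?Q C) \<and> _")
  proof (intro conjI)
    \<comment> \<open>Beyond the threshold of \<open>i\<close> the premise of \<open>ii\<close>
      holds.\<close>
    show "\<exists>C0>1. \<forall>C\<ge>C0. ?Q C"
    proof (intro exI[of _ "max B 2"] conjI allI impI)
      fix C assume "C \<ge> max B 2"
      with i show "?Q C" by (intro ii) auto
    qed (use i in blast)
  qed (use i ii in blast)+
qed

end
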